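(* Let $(W,S)$ be a Coxeter system of type $B_n$, $n\ge 2$. Then, for all $0\le j,k\le n$, $$x_j\,x_k=\sum_{l=0}^{\min(j,k)} \binom{n-j}{k-l}\binom{n-k}{j-l}(n-j-k+l)!\,2^{n-j-k+l}\,x_{l}.$$
   Context: For a finite Coxeter system $(W,S)$ with length function $\ell$ and $J\subseteq S$, let $X_J=\{w\in W: \ell(ws)>\ell(w)\text{ for all } s\in J\}$ and $x_J=\sum_{w\in X_J} w$ in the group algebra $\mathbb{Q}W$. For type $B_n$ label $S=\{s_1,\dots,s_n\}$ so that $s_1s_2$ has order $4$, $s_is_{i+1}$ has order $3$ for $2\le i\le n-1$, and all other pairs of distinct generators commute. For $0\le j\le n$ put $x_j=x_{\{s_1,\dots,s_j\}}$ (so $x_n=1$ and $x_0=\sum_{w\in W}w$). Convention: terms with $n-j-k+l<0$ are zero (then both binomial coefficients vanish). *)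

theory Defs
  imports "HOL-Algebra.Algebra"
begin

definition word_prod :: "('a, 'm) monoid_scheme \<Rightarrow> 'a list \<Rightarrow> 'a" where
  "word_prod W us = foldr (\<otimes>\<^bsub>W\<^esub>) us \<one>\<^bsub>W\<^esub>"

text \<open>The relators are the words \<open>(s t)^m\<close> with \<open>m\<close> the order of \<open>s t\<close>.  Infinite order is
  encoded as \<open>ord = 0\<close> in HOL-Algebra, which yields the empty (trivial) relator, as it should.
  For \<open>s = t\<close> the relator is \<open>[s, s]\<close>.\<close>

definition coxeter_relators :: "('a, 'm) monoid_scheme \<Rightarrow> 'a set \<Rightarrow> 'a list set" where
  "coxeter_relators W S =
     {concat (replicate (group.ord W (s \<otimes>\<^bsub>W\<^esub> t)) [s, t]) | s t. s \<in> S \<and> t \<in> S}"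

text \<open>The congruence on the free monoid over \<open>S\<close> generated by setting the relators to \<open>1\<close>.  As all
  \<open>[s, s]\<close> are relators, generators are their own inverses in the quotient monoid, which therefore is
  the group with presentation \<open>\<langle>S | (s t)^m(s,t) = 1\<rangle>\<close>.\<close>

inductive coxeter_cong :: "('a, 'm) monoid_scheme \<Rightarrow> 'a set \<Rightarrow> 'a list \<Rightarrow> 'a list \<Rightarrow> bool"
  for W S where
  relator: "\<lbrakk>u \<in> lists S; r \<in> coxeter_relators W S; v \<in> lists S\<rbrakk> \<Longrightarrow> coxeter_cong W S (u @ r @ v) (u @ v)"
| refl: "u \<in> lists S \<Longrightarrow> coxeter_cong W S u u"
| sym: "coxeter_cong W S u v \<Longrightarrow> coxeter_cong W S v u"
| trans: "coxeter_cong W S u v \<Longrightarrow> coxeter_cong W S v w \<Longrightarrow> coxeter_cong W S u w"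

definition coxeter_system :: "('a, 'm) monoid_scheme \<Rightarrow> 'a set \<Rightarrow> bool" where
  "coxeter_system W S \<longleftrightarrow>
     group W \<and> S \<subseteq> carrier W \<and> generate W S = carrier W \<and>
     (\<forall>s\<in>S. group.ord W s = 2) \<and>
     (\<forall>u\<in>lists S. \<forall>v\<in>lists S. word_prod W u = word_prod W v \<longleftrightarrow> coxeter_cong W S u v)"

definition coxeter_length :: "('a, 'm) monoid_scheme \<Rightarrow> 'a set \<Rightarrow> 'a \<Rightarrow> nat" where
  "coxeter_length W S w = (LEAST k. \<exists>us\<in>lists S. length us = k \<and> word_prod W us = w)"

text \<open>Distinct generators commute iff their product has order 2, so this fixes the whole Coxeter matrix.\<close>

definition coxeter_type_B ::
    "('a, 'm) monoid_scheme \<Rightarrow> 'a set \<Rightarrow> nat \<Rightarrow> (nat \<Rightarrow> 'a) \<Rightarrow> bool" where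
  "coxeter_type_B W S n s \<longleftrightarrow>
     coxeter_system W S \<and> bij_betw s {1..n} S \<and>
     group.ord W (s 1 \<otimes>\<^bsub>W\<^esub> s 2) = 4 \<and>
     (\<forall>i\<in>{2..n - 1}. group.ord W (s i \<otimes>\<^bsub>W\<^esub> s (i + 1)) = 3) \<and>
     (\<forall>i\<in>{1..n}. \<forall>j\<in>{1..n}. i + 1 < j \<longrightarrow> s i \<otimes>\<^bsub>W\<^esub> s j = s j \<otimes>\<^bsub>W\<^esub> s i)"

text \<open>Elements are the finitely supported functions on \<open>W\<close>, extended by \<open>0\<close> outside the carrier.\<close>

definition group_algebra :: "('a, 'm) monoid_scheme \<Rightarrow> (rat, 'a \<Rightarrow> rat) module" where
  "group_algebra W =
     \<lparr>carrier = {f. finite {w. f w \<noteq> 0} \<and> {w. f w \<noteq> 0} \<subseteq> carrier W},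
      monoid.mult = (\<lambda>f g w. if w \<in> carrier W
                then (\<Sum>u\<in>{u. f u \<noteq> 0}. f u * g (inv\<^bsub>W\<^esub> u \<otimes>\<^bsub>W\<^esub> w)) else 0),
      one = (\<lambda>w. if w = \<one>\<^bsub>W\<^esub> then 1 else 0),
      ring.zero = (\<lambda>_. 0),
      add = (\<lambda>f g w. f w + g w),
      smult = (\<lambda>c f w. c * f w)\<rparr>"

definition group_elem :: "'a \<Rightarrow> 'a \<Rightarrow> rat" where
  "group_elem u = (\<lambda>w. if w = u then 1 else 0)"

lemma group_elem_closed: "u \<in> carrier W \<Longrightarrow> group_elem u \<in> carrier (group_algebra W)"
  by (auto simp: group_algebra_def group_elem_def)

lemma abelian_group_group_algebra: "abelian_group (group_algebra W)"
proof (rule abelian_groupI)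
  fix f g assume "f \<in> carrier (group_algebra W)" "g \<in> carrier (group_algebra W)"
  moreover have "{w. f w + g w \<noteq> 0} \<subseteq> {w. f w \<noteq> 0} \<union> {w. g w \<noteq> 0}" by auto
  ultimately show "f \<oplus>\<^bsub>group_algebra W\<^esub> g \<in> carrier (group_algebra W)"
    by (auto simp: group_algebra_def intro: finite_subset)
next
  fix f assume "f \<in> carrier (group_algebra W)"
  then show "\<exists>g\<in>carrier (group_algebra W). g \<oplus>\<^bsub>group_algebra W\<^esub> f = \<zero>\<^bsub>group_algebra W\<^esub>"
    by (intro bexI[of _ "\<lambda>w. - f w"]) (auto simp: group_algebra_def)
qed (auto simp: group_algebra_def ac_simps)

lemma group_elem_mult:
  assumes "group W" "u \<in> carrier W" "v \<in> carrier W"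
  shows "group_elem u \<otimes>\<^bsub>group_algebra W\<^esub> group_elem v = group_elem (u \<otimes>\<^bsub>W\<^esub> v)"
proof -
  interpret group W by fact
  have "{w. group_elem u w \<noteq> 0} = {u}" by (auto simp: group_elem_def)
  moreover have "inv\<^bsub>W\<^esub> u \<otimes>\<^bsub>W\<^esub> w = v \<longleftrightarrow> w = u \<otimes>\<^bsub>W\<^esub> v" if "w \<in> carrier W" for w
    using that assms by (metis inv_solve_left)
  ultimately show ?thesis
    using assms by (auto simp: group_algebra_def group_elem_def fun_eq_iff)
qed

definition coxeter_X :: "('a, 'm) monoid_scheme \<Rightarrow> 'a set \<Rightarrow> 'a set \<Rightarrow> 'a set" where
  "coxeter_X W S J =
     {w \<in> carrier W. \<forall>s\<in>J. coxeter_length W S (w \<otimes>\<^bsub>W\<^esub> s) > coxeter_length W S w}"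

text \<open>Meaningful for finite \<open>W\<close> only: \<open>finsum\<close> over an infinite set is \<open>\<zero>\<close>.\<close>

definition coxeter_x :: "('a, 'm) monoid_scheme \<Rightarrow> 'a set \<Rightarrow> 'a set \<Rightarrow> 'a \<Rightarrow> rat" where
  "coxeter_x W S J = (\<Oplus>\<^bsub>group_algebra W\<^esub>w\<in>coxeter_X W S J. group_elem w)"

end

(* The generators act on the integers as s_1 = (1 -1) and s_i = (i-1 i)(-(i-1) -i); the presentation
   makes this a homomorphism w |-> act w, and enumerating the cosets of the parabolic subgroups of type
   B_(m-1) in those of type B_m shows that it is faithful.  The exchange condition then turns descents of
   w into descents of act w, so that X_{s_1..s_k} consists of the w with
   0 < act w 1 < ... < act w k.

   For u in X_{s_1..s_(n-1)}, passing from w to u^-1 w relabels the values of act w monotonically,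
   except that the value p = act u n becomes n and -p becomes -n.  Counting the admissible u by the
   position of p in act w gives
     x_(n-1) x_k = 2(n-k) x_k + x_(k-1).
   Hence x_j is the falling factorial y(y-2)(y-4)... with n-j factors at y = x_(n-1), and the claim is
   the product rule for falling factorials, proved by downward induction on j. *)

theory Submission
  imports Defs
begin

section \<open>Signed reflections of the integers\<close>

text \<open>\<open>s i\<close> will act as the swap of \<open>lower_nbr i\<close> and
  \<open>int i\<close>, continued oddly. The value \<open>- 1\<close> at index 1 makes the sign
  change of 1 an instance of the same formula.\<close>

definition lower_nbr :: "nat \<Rightarrow> int" where
  "lower_nbr i = (if i = 1 then - 1 else int i - 1)"

definition sgn_refl :: "nat \<Rightarrow> int \<Rightarrow> int" where
  "sgn_refl i x = (if x = int i then lower_nbr i else if x = lower_nbr i then int i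
     else if x = - int i then - lower_nbr i else if x = - lower_nbr i then - int i else x)"

text \<open>Index 1 is separate because there the swapped pair is its own negative; for larger
  indices the pair and its negative are disjoint.\<close>

lemma sgn_refl_cases:
  assumes "i \<ge> 1"
  obtains "i = 1" "x = 1" "sgn_refl i x = - 1"
    | "i = 1" "x = - 1" "sgn_refl i x = 1"
    | "2 \<le> i" "x = int i" "sgn_refl i x = int i - 1"
    | "2 \<le> i" "x = int i - 1" "sgn_refl i x = int i"
    | "2 \<le> i" "x = - int i" "sgn_refl i x = 1 - int i"
    | "2 \<le> i" "x = 1 - int i" "sgn_refl i x = - int i"
    | "i = 1" "x \<noteq> 1" "x \<noteq> - 1" "sgn_refl i x = x"
    | "2 \<le> i" "x \<noteq> int i" "x \<noteq> int i - 1" "x \<noteq> - int i" "x \<noteq> 1 - int i" "sgn_refl i x = x"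
proof (cases "i = 1")
  case True
  then show ?thesis using that(1,2,7)
    by (cases "x = 1"; cases "x = - 1") (simp_all add: sgn_refl_def lower_nbr_def)
next
  case False
  then have i: "2 \<le> i" using assms by simp
  consider "x = int i" | "x = int i - 1" | "x = - int i" | "x = 1 - int i"
    | "x \<noteq> int i \<and> x \<noteq> int i - 1 \<and> x \<noteq> - int i \<and> x \<noteq> 1 - int i" by blast
  then show ?thesis using i
    by cases (rule that(3-6,8); simp add: sgn_refl_def lower_nbr_def)+
qed

lemma sgn_refl_1: "sgn_refl (Suc 0) x = (if x = 1 \<or> x = - 1 then - x else x)"
  by (simp add: sgn_refl_def lower_nbr_def)

lemma sgn_refl_ge2: "2 \<le> i \<Longrightarrow> sgn_refl i x = (if x = int i then int i - 1 else if x = int i - 1 then int i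
     else if x = - int i then 1 - int i else if x = 1 - int i then - int i else x)"
  by (simp add: sgn_refl_def lower_nbr_def)

lemma sgn_refl_invol [simp]: "i \<ge> 1 \<Longrightarrow> sgn_refl i (sgn_refl i x) = x"
  by (rule sgn_refl_cases[of i x]) (simp_all add: sgn_refl_1 sgn_refl_ge2)

lemma sgn_refl_minus: "i \<ge> 1 \<Longrightarrow> sgn_refl i (- x) = - sgn_refl i x"
  by (rule sgn_refl_cases[of i x]) (simp_all add: sgn_refl_1 sgn_refl_ge2)

lemma sgn_refl_far:
  assumes "1 \<le> i" "\<bar>x\<bar> < int i - 1 \<or> int i < \<bar>x\<bar>"
  shows "sgn_refl i x = x"
  using assms(1) by (rule sgn_refl_cases[of i x]) (use assms(2) in simp_all)

lemma sgn_refl_near: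
  assumes "1 \<le> i" "int i - 1 \<le> \<bar>x\<bar>" "\<bar>x\<bar> \<le> int i"
  shows "int i - 1 \<le> \<bar>sgn_refl i x\<bar>" "\<bar>sgn_refl i x\<bar> \<le> int i"
  using assms(1) by (rule sgn_refl_cases[of i x]; use assms(2,3) in simp)+

text \<open>\<open>sgn_refl i\<close> moves only points of absolute value \<open>i - 1\<close> or
  \<open>i\<close>, so reflections with distant indices move disjoint sets of points.\<close>

lemma sgn_refl_commute:
  assumes "1 \<le> i" "i + 1 < j"
  shows "sgn_refl i (sgn_refl j x) = sgn_refl j (sgn_refl i x)"
proof (cases "\<bar>x\<bar> \<le> int i")
  case True
  moreover have "\<bar>sgn_refl i x\<bar> \<le> int i"
    using True assms by (cases "int i - 1 \<le> \<bar>x\<bar>") (simp_all add: sgn_refl_near sgn_refl_far)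
  ultimately show ?thesis using assms by (simp add: sgn_refl_far)
next
  case False
  moreover have "int i < \<bar>sgn_refl j x\<bar>"
  proof (cases "int j - 1 \<le> \<bar>x\<bar> \<and> \<bar>x\<bar> \<le> int j")
    case True
    then show ?thesis using sgn_refl_near(1)[of j x] assms by linarith
  next
    case f: False
    then have "sgn_refl j x = x" using assms by (intro sgn_refl_far) linarith+
    then show ?thesis using False by simp
  qed
  ultimately show ?thesis using assms by (simp add: sgn_refl_far)
qed

lemma sgn_refl_braid3:
  assumes "2 \<le> i"
  shows "sgn_refl i (sgn_refl (i + 1) (sgn_refl i x)) =
     sgn_refl (i + 1) (sgn_refl i (sgn_refl (i + 1) x))"
proof -
  consider "x = int i - 1" | "x = int i" | "x = int i + 1"
    | "x = 1 - int i" | "x = - int i" | "x = - int i - 1"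
    | "x \<noteq> int i - 1 \<and> x \<noteq> int i \<and> x \<noteq> int i + 1 \<and> x \<noteq> 1 - int i \<and> x \<noteq> - int i \<and> x \<noteq> - int i - 1"
    by blast
  then show ?thesis
    using assms by cases (simp_all add: sgn_refl_ge2)
qed

lemma sgn_refl_braid4:
  "sgn_refl 1 (sgn_refl 2 (sgn_refl 1 (sgn_refl 2 x))) =
     sgn_refl 2 (sgn_refl 1 (sgn_refl 2 (sgn_refl 1 x)))"
proof -
  consider "x = 1" | "x = -1" | "x = 2" | "x = -2" | "x \<noteq> 1 \<and> x \<noteq> -1 \<and> x \<noteq> 2 \<and> x \<noteq> -2" by blast
  then show ?thesis
    by cases (simp_all add: sgn_refl_1 sgn_refl_ge2)
qed

text \<open>For \<open>i\<close> at least 2 each point moves by at most 1, so a reversed pair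
  consists of neighbours that change places. Zero is excluded because \<open>sgn_refl 1\<close> also
  reverses (-1, 0) and (0, 1).\<close>

lemma sgn_refl_reversal:
  assumes "i \<ge> 1" "x \<noteq> 0" "y \<noteq> 0" "x < y" "sgn_refl i y < sgn_refl i x"
  shows "x = lower_nbr i \<and> y = int i \<or> x = - int i \<and> y = - lower_nbr i"
proof (cases "i = 1")
  case True
  have "\<bar>z\<bar> = 1 \<Longrightarrow> z = 1 \<or> z = - 1" for z :: int by arith
  then show ?thesis
    using assms by (cases "\<bar>x\<bar> = 1"; cases "\<bar>y\<bar> = 1") (auto simp: True sgn_refl_1 lower_nbr_def split: if_splits)
next
  case False
  then have i: "2 \<le> i" using assms(1) by simp
  have step: "\<bar>sgn_refl i z - z\<bar> \<le> 1" for z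
    using i by (simp add: sgn_refl_ge2)
  have "sgn_refl i x = x + 1" using step[of x] step[of y] assms(4,5) by linarith
  moreover from this have "x = int i - 1 \<or> x = - int i"
    using assms(1) by (rule_tac sgn_refl_cases[of i x]) simp_all
  moreover have "y = x + 1" using step[of x] step[of y] assms(4,5) by linarith
  ultimately show ?thesis using False by (auto simp: lower_nbr_def)
qed

section \<open>The action of the group on the integers\<close>

text \<open>Transfers a power relation for a product of two reflections to the product in the
  opposite order, which is its inverse.\<close>

lemma funpow_left_inverse:
  assumes "f ^^ m = id" "g \<circ> f = id"
  shows "g ^^ m = id"
proof -
  have "(g ^^ m) ((f ^^ m) x) = x" for m x
  proof (induction m)
    case (Suc m)
    have "(g ^^ Suc m) ((f ^^ Suc m) x) = (g ^^ m) ((g \<circ> f) ((f ^^ m) x))"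
      by (simp add: funpow_swap1)
    then show ?case using Suc assms(2) by simp
  qed simp
  then show ?thesis using assms(1) by (metis ext id_apply)
qed

locale coxeter_B = group W for W (structure) +
  fixes S :: "'a set" and n :: nat and s :: "nat \<Rightarrow> 'a"
  assumes n_ge_2: "2 \<le> n" and type_B: "coxeter_type_B W S n s"
begin

section \<open>The type B relations among the generators\<close>

abbreviation idx :: "nat set" where "idx \<equiv> {1..n}"

lemma system: "coxeter_system W S"
  using type_B by (simp add: coxeter_type_B_def)

lemma S_eq: "S = s ` idx" and inj_s: "inj_on s idx"
  using type_B by (auto simp: coxeter_type_B_def bij_betw_def)

lemma S_closed: "S \<subseteq> carrier W"
  using system by (simp add: coxeter_system_def)

lemma s_closed [simp, intro]: "i \<in> idx \<Longrightarrow> s i \<in> carrier W"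
  using S_eq S_closed by blast

lemma s_sq: "i \<in> idx \<Longrightarrow> s i \<otimes> s i = \<one>"
proof -
  assume i: "i \<in> idx"
  then have "ord (s i) = 2" using system S_eq by (auto simp: coxeter_system_def)
  then show ?thesis using pow_ord_eq_1[of "s i"] i by (simp add: numeral_2_eq_2)
qed

lemma s_cancel [simp]: "i \<in> idx \<Longrightarrow> x \<in> carrier W \<Longrightarrow> s i \<otimes> (s i \<otimes> x) = x"
  by (simp add: s_sq m_assoc[symmetric])

lemma inv_s [simp]: "i \<in> idx \<Longrightarrow> inv (s i) = s i"
  by (rule inv_equality) (simp_all add: s_sq)

lemma s_commute:
  "i \<in> idx \<Longrightarrow> j \<in> idx \<Longrightarrow> i + 1 < j \<or> j + 1 < i \<Longrightarrow> s i \<otimes> s j = s j \<otimes> s i"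
  using type_B unfolding coxeter_type_B_def by metis

lemma ord_3: "2 \<le> i \<Longrightarrow> i < n \<Longrightarrow> ord (s i \<otimes> s (i + 1)) = 3"
  and ord_4: "ord (s 1 \<otimes> s 2) = 4"
  using type_B by (auto simp: coxeter_type_B_def)

text \<open>For generators a and b, (ab)^3 = 1 splits as (aba)(bab) = 1, and bab is its own
  inverse.\<close>

lemma s_braid3:
  assumes "2 \<le> i" "i < n"
  shows "s i \<otimes> s (i + 1) \<otimes> s i = s (i + 1) \<otimes> s i \<otimes> s (i + 1)"
proof -
  have i: "i \<in> idx" "i + 1 \<in> idx" using assms by auto
  have "(s i \<otimes> s (i + 1)) [^] (3::nat) = \<one>"
    by (metis i ord_3[OF assms] pow_ord_eq_1 m_closed s_closed)
  then have "(s i \<otimes> s (i + 1) \<otimes> s i) \<otimes> (s (i + 1) \<otimes> s i \<otimes> s (i + 1)) = \<one>"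
    using i by (simp add: numeral_3_eq_3 m_assoc)
  then have "s i \<otimes> s (i + 1) \<otimes> s i = inv (s (i + 1) \<otimes> s i \<otimes> s (i + 1))"
    using i by (metis inv_equality inv_inv m_closed s_closed)
  then show ?thesis using i by (simp add: inv_mult_group m_assoc)
qed

lemma s_braid4: "s 1 \<otimes> s 2 \<otimes> s 1 \<otimes> s 2 = s 2 \<otimes> s 1 \<otimes> s 2 \<otimes> s 1"
proof -
  have i: "1 \<in> idx" "2 \<in> idx" using n_ge_2 by auto
  have "(s 1 \<otimes> s 2) [^] (4::nat) = \<one>"
    by (metis i ord_4 pow_ord_eq_1 m_closed s_closed)
  then have "(s 1 \<otimes> s 2 \<otimes> s 1 \<otimes> s 2) \<otimes> (s 1 \<otimes> s 2 \<otimes> s 1 \<otimes> s 2) = \<one>"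
    using s_closed[OF i(1)] s_closed[OF i(2)] by (simp add: eval_nat_numeral m_assoc)
  then have "s 1 \<otimes> s 2 \<otimes> s 1 \<otimes> s 2 = inv (s 1 \<otimes> s 2 \<otimes> s 1 \<otimes> s 2)"
    by (metis i inv_equality m_closed s_closed)
  also have "\<dots> = s 2 \<otimes> s 1 \<otimes> s 2 \<otimes> s 1"
    using s_closed[OF i(1)] s_closed[OF i(2)] inv_s[OF i(1)] inv_s[OF i(2)]
    by (simp add: inv_mult_group m_assoc del: s_closed inv_s)
  finally show ?thesis .
qed

section \<open>Words in the generators\<close>

lemma word_prod_closed [simp]: "us \<in> lists S \<Longrightarrow> word_prod W us \<in> carrier W"
  by (induction us) (use S_closed in \<open>auto simp: word_prod_def\<close>)

lemma word_prod_append: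
  "us \<in> lists S \<Longrightarrow> vs \<in> lists S \<Longrightarrow> word_prod W (us @ vs) = word_prod W us \<otimes> word_prod W vs"
proof (induction us)
  case (Cons u us)
  then show ?case using S_closed word_prod_closed
    by (auto simp: word_prod_def m_assoc subset_iff)
qed (use word_prod_closed in \<open>auto simp: word_prod_def\<close>)

lemma word_prod_Cons: "word_prod W (x # us) = x \<otimes> word_prod W us"
  by (simp add: word_prod_def)

lemma word_prod_Nil: "word_prod W [] = \<one>"
  by (simp add: word_prod_def)

lemma generate_word:
  assumes "T \<subseteq> S" "w \<in> generate W T"
  shows "\<exists>us\<in>lists T. word_prod W us = w"
  using assms(2)
proof (induction rule: generate.induct)
  case one
  then show ?case by (intro bexI[of _ "[]"]) (auto simp: word_prod_Nil)
next
  case (incl h)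
  then have "h \<in> carrier W" using assms(1) S_closed by blast
  then show ?case using incl by (intro bexI[of _ "[h]"]) (auto simp: word_prod_Nil word_prod_Cons)
next
  case (inv h)
  then have h: "h \<in> carrier W" "inv h = h" using assms(1) S_closed S_eq by auto
  then show ?case using inv by (intro bexI[of _ "[h]"]) (auto simp: word_prod_Nil word_prod_Cons)
next
  case (eng h1 h2)
  then obtain us vs where "us \<in> lists T" "vs \<in> lists T" "word_prod W us = h1" "word_prod W vs = h2"
    by blast
  moreover from this have "us \<in> lists S" "vs \<in> lists S" using assms(1) lists_mono by blast+
  ultimately show ?case
    by (intro bexI[of _ "us @ vs"]) (auto simp: word_prod_append)
qed

lemma exists_word: "w \<in> carrier W \<Longrightarrow> \<exists>us\<in>lists S. word_prod W us = w"
  using generate_word[of S w] system by (simp add: coxeter_system_def)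

section \<open>From words to an action of the group\<close>

definition word_act :: "'a list \<Rightarrow> int \<Rightarrow> int" where
  "word_act us = foldr (\<lambda>x f. sgn_refl (inv_into idx s x) \<circ> f) us id"

lemma word_act_Nil: "word_act [] = id"
  and word_act_Cons: "i \<in> idx \<Longrightarrow> word_act (s i # us) = sgn_refl i \<circ> word_act us"
  using inj_s by (simp_all add: word_act_def)

lemma word_act_append: "word_act (us @ vs) = word_act us \<circ> word_act vs"
  by (induction us) (simp_all add: word_act_def comp_assoc)

lemma word_act_power:
  "i \<in> idx \<Longrightarrow> j \<in> idx \<Longrightarrow>
    word_act (concat (replicate m [s i, s j])) = (sgn_refl i \<circ> sgn_refl j) ^^ m"
  by (induction m) (auto simp: word_act_Nil word_act_Cons fun_eq_iff)

text \<open>The braid identities settle the orders 3 and 4. For distant indices the type provides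
  only commutation; order 2 then follows because injectivity of \<open>s\<close> excludes order
  1.\<close>

lemma sgn_refl_power_ord_aux:
  assumes "i \<in> idx" "j \<in> idx" "i < j"
  shows "(sgn_refl i \<circ> sgn_refl j) ^^ ord (s i \<otimes> s j) = id"
proof -
  consider "j = i + 1" "2 \<le> i" | "i = 1" "j = 2" | "i + 1 < j"
    using assms by fastforce
  then show ?thesis
  proof cases
    case 1
    then have "ord (s i \<otimes> s j) = 3" using ord_3 assms by simp
    then show ?thesis using sgn_refl_braid3[OF 1(2)] 1
      by (simp add: fun_eq_iff numeral_3_eq_3)
  next
    case 2
    then have "ord (s i \<otimes> s j) = 4" using ord_4 by simp
    then show ?thesis using sgn_refl_braid4 2
      by (simp add: fun_eq_iff eval_nat_numeral)
  next
    case 3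
    have c: "s i \<in> carrier W" "s j \<in> carrier W" using assms by auto
    have "(s i \<otimes> s j) \<otimes> (s i \<otimes> s j) = s i \<otimes> (s j \<otimes> s i) \<otimes> s j"
      using c by (simp add: m_assoc)
    also have "\<dots> = \<one>"
      using c assms s_commute[of j i] 3 by (simp add: m_assoc s_sq)
    finally have "(s i \<otimes> s j) [^] (2::nat) = \<one>"
      using c by (simp add: numeral_2_eq_2)
    then have "ord (s i \<otimes> s j) dvd 2" using c by (simp add: pow_eq_id)
    moreover have "s i \<otimes> s j \<noteq> \<one>"
      using inj_s assms by (metis c inv_equality inv_s inj_onD less_irrefl)
    then have "ord (s i \<otimes> s j) \<noteq> 1" using c ord_eq_1 by blast
    ultimately have "ord (s i \<otimes> s j) = 2"
      using two_is_prime_nat prime_nat_iff by blast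
    then show ?thesis using sgn_refl_commute[of i j] assms 3
      by (simp add: fun_eq_iff numeral_2_eq_2)
  qed
qed

lemma sgn_refl_power_ord:
  assumes "i \<in> idx" "j \<in> idx"
  shows "(sgn_refl i \<circ> sgn_refl j) ^^ ord (s i \<otimes> s j) = id"
proof -
  consider "i = j" | "i < j" | "j < i" by linarith
  then show ?thesis
  proof cases
    case 1
    then show ?thesis using assms using ord_eq_1[of "\<one>"] by (simp add: s_sq fun_eq_iff)
  next
    case 2
    then show ?thesis using sgn_refl_power_ord_aux assms by blast
  next
    case 3
    have "s i \<otimes> s j = inv (s j \<otimes> s i)" using assms by (simp add: inv_mult_group)
    then have "ord (s i \<otimes> s j) = ord (s j \<otimes> s i)" using assms ord_inv by simp
    moreover have "(sgn_refl i \<circ> sgn_refl j) ^^ ord (s j \<otimes> s i) = id"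
      using sgn_refl_power_ord_aux[OF assms(2,1) 3] assms
      by (rule_tac funpow_left_inverse) (auto simp: fun_eq_iff)
    ultimately show ?thesis by simp
  qed
qed

lemma word_act_relator: "r \<in> coxeter_relators W S \<Longrightarrow> word_act r = id"
  by (auto simp: coxeter_relators_def S_eq word_act_power sgn_refl_power_ord
      simp del: One_nat_def atLeastAtMost_iff)

lemma word_act_cong: "coxeter_cong W S u v \<Longrightarrow> word_act u = word_act v"
  by (induction rule: coxeter_cong.induct) (simp_all add: word_act_append word_act_relator)

text \<open>The choice of word is immaterial: by the presentation, two words for the same element
  are congruent, and congruent words act equally.\<close>

definition act :: "'a \<Rightarrow> int \<Rightarrow> int" where
  "act w = word_act (SOME us. us \<in> lists S \<and> word_prod W us = w)"

lemma act_word_prod: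
  assumes "us \<in> lists S"
  shows "act (word_prod W us) = word_act us"
proof -
  let ?vs = "SOME vs. vs \<in> lists S \<and> word_prod W vs = word_prod W us"
  have "?vs \<in> lists S \<and> word_prod W ?vs = word_prod W us"
    by (rule someI[of _ us]) (use assms in simp)
  then have "coxeter_cong W S ?vs us"
    using system assms unfolding coxeter_system_def by blast
  then show ?thesis unfolding act_def by (rule word_act_cong)
qed

lemma act_one: "act \<one> = id"
  using act_word_prod[of "[]"] by (simp add: word_prod_Nil word_act_Nil)

lemma act_s: "i \<in> idx \<Longrightarrow> act (s i) = sgn_refl i"
  using act_word_prod[of "[s i]"] S_eq
  by (simp add: word_prod_Nil word_prod_Cons word_act_Nil word_act_Cons del: One_nat_def atLeastAtMost_iff)

lemma act_mult: 
  assumes "u \<in> carrier W" "v \<in> carrier W"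
  shows "act (u \<otimes> v) = act u \<circ> act v"
proof -
  obtain us vs where "us \<in> lists S" "vs \<in> lists S" "word_prod W us = u" "word_prod W vs = v"
    using exists_word assms by meson
  then show ?thesis
    using act_word_prod[of us] act_word_prod[of vs] act_word_prod[of "us @ vs"]
    by (simp add: word_prod_append word_act_append)
qed

lemma act_inv_left: "w \<in> carrier W \<Longrightarrow> act (inv w) (act w x) = x"
  using act_mult[of "inv w" w] act_one by (simp add: fun_eq_iff)

lemma act_inv_right: "w \<in> carrier W \<Longrightarrow> act w (act (inv w) x) = x"
  using act_mult[of w "inv w"] act_one by (simp add: fun_eq_iff)

lemma act_eq_iff: "w \<in> carrier W \<Longrightarrow> act w x = act w y \<longleftrightarrow> x = y"
  using act_inv_left by metis

lemma act_induct [consumes 1, case_names one step]: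
  assumes "w \<in> carrier W" "P \<one>"
    "\<And>i v. \<lbrakk>i \<in> idx; v \<in> carrier W; P v\<rbrakk> \<Longrightarrow> P (s i \<otimes> v)"
  shows "P w"
proof -
  have "P (word_prod W us)" if "us \<in> lists S" for us
    using that
  proof (induction us)
    case (Cons x us)
    then obtain i where "i \<in> idx" "x = s i" using S_eq by auto
    then show ?case using assms(3) Cons by (simp add: word_prod_Cons)
  qed (simp add: word_prod_Nil assms(2))
  then show ?thesis using exists_word[OF assms(1)] by blast
qed

lemma act_minus: "w \<in> carrier W \<Longrightarrow> act w (- x) = - act w x"
  by (induction arbitrary: x rule: act_induct) (auto simp: act_one act_mult act_s sgn_refl_minus)

lemma act_0 [simp]: "w \<in> carrier W \<Longrightarrow> act w 0 = 0"
  using act_minus[of w 0] by simp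

lemma act_eq_0_iff: "w \<in> carrier W \<Longrightarrow> act w x = 0 \<longleftrightarrow> x = 0"
  using act_eq_iff[of w x 0] by simp

lemma act_far: "w \<in> carrier W \<Longrightarrow> int n < \<bar>x\<bar> \<Longrightarrow> act w x = x"
  by (induction rule: act_induct) (auto simp: act_one act_mult act_s sgn_refl_far)

text \<open>Points beyond \<open>n\<close> are fixed. If \<open>act w x\<close> were such a point,
  injectivity would force \<open>act w x = x\<close>.\<close>

lemma act_bounded: "w \<in> carrier W \<Longrightarrow> \<bar>x\<bar> \<le> int n \<Longrightarrow> \<bar>act w x\<bar> \<le> int n"
  using act_far[of w "act w x"] act_eq_iff[of w "act w x" x] by fastforce

end

section \<open>Faithfulness\<close>

context coxeter_B
begin

section \<open>Parabolic subgroups of the first generators\<close>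

definition parabolic :: "nat \<Rightarrow> 'a set" where
  "parabolic m = generate W (s ` {1..m})"

lemma parabolic_subgroup: "m \<le> n \<Longrightarrow> subgroup (parabolic m) W"
  unfolding parabolic_def by (intro generate_is_subgroup) auto

lemma parabolic_closed: "m \<le> n \<Longrightarrow> w \<in> parabolic m \<Longrightarrow> w \<in> carrier W"
  using parabolic_subgroup subgroup.mem_carrier by fast

lemma parabolic_0: "parabolic 0 = {\<one>}"
  by (simp add: parabolic_def generate_empty)

lemma parabolic_n: "parabolic n = carrier W"
  using system by (simp add: parabolic_def coxeter_system_def S_eq)

lemma s_in_parabolic: "1 \<le> i \<Longrightarrow> i \<le> m \<Longrightarrow> s i \<in> parabolic m"
  unfolding parabolic_def by (intro generate.incl) auto

lemma parabolic_induct [consumes 2, case_names one step]: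
  assumes "w \<in> parabolic m" "m \<le> n" "P \<one>"
    "\<And>i v. \<lbrakk>1 \<le> i; i \<le> m; v \<in> carrier W; P v\<rbrakk> \<Longrightarrow> P (s i \<otimes> v)"
  shows "P w"
proof -
  have sub: "s ` {1..m} \<subseteq> S" using assms(2) S_eq by auto
  have "P (word_prod W us)" if "us \<in> lists (s ` {1..m})" for us
    using that
  proof (induction us)
    case (Cons x us)
    then obtain i where "1 \<le> i" "i \<le> m" "x = s i" by auto
    moreover have "us \<in> lists S" using Cons.hyps(2) sub by blast
    ultimately show ?case using assms(4) Cons by (simp add: word_prod_Cons)
  qed (simp add: word_prod_Nil assms(3))
  then show ?thesis using generate_word[OF sub] assms(1) unfolding parabolic_def by blast
qed

lemma act_parabolic_fixes:
  assumes "w \<in> parabolic m" "m \<le> n" "int m < \<bar>x\<bar>"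
  shows "act w x = x"
  using assms(1,2)
proof (induction rule: parabolic_induct)
  case (step i v)
  then have "i \<in> idx" using assms(2) by simp
  then show ?case using step assms(3) by (simp add: act_mult act_s sgn_refl_far del: atLeastAtMost_iff)
qed (simp add: act_one)

text \<open>Left multiplication by generators moves the coset of \<open>parabolic (m - 1)\<close> in \<open>parabolic m\<close>
  along the path \<open>m, m - 1, \<dots>, 1, -1, \<dots>, -m\<close>, the orbit of \<open>m\<close>; \<open>path_edge m k\<close> labels the step
  from node \<open>k - 1\<close> to node \<open>k\<close>, and the label \<open>m + 1\<close> beyond both ends does not occur.\<close>

definition path_edge :: "nat \<Rightarrow> nat \<Rightarrow> nat" where
  "path_edge m k = (if k \<le> m then m + 1 - k else k + 1 - m)"

text \<open>The labels of the first \<open>k\<close> edges, the latest one leftmost, so that the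
  product carries \<open>m\<close> along the path to node \<open>k\<close>.\<close>

primrec path_elem :: "nat \<Rightarrow> nat \<Rightarrow> 'a" where
  "path_elem m 0 = \<one>"
| "path_elem m (Suc k) = s (path_edge m (Suc k)) \<otimes> path_elem m k"

text \<open>The extra \<open>- 1\<close> from node \<open>m\<close> on makes the path skip
  0.\<close>

definition path_node :: "nat \<Rightarrow> nat \<Rightarrow> int" where
  "path_node m k = (if k < m then int m - int k else int m - int k - 1)"

lemma path_edge_range: "1 \<le> k \<Longrightarrow> k < 2 * m \<Longrightarrow> 1 \<le> path_edge m k \<and> path_edge m k \<le> m"
  by (auto simp: path_edge_def)

lemma path_elem_closed: "m \<le> n \<Longrightarrow> k < 2 * m \<Longrightarrow> path_elem m k \<in> carrier W"
proof (induction k)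
  case (Suc k)
  then show ?case using path_edge_range[of "Suc k" m] by auto
qed simp

lemma sgn_refl_path:
  assumes "1 \<le> m" "Suc k < 2 * m"
  shows "sgn_refl (path_edge m (Suc k)) (path_node m k) = path_node m (Suc k)"
proof -
  consider "Suc k < m" | "Suc k = m" | "m \<le> k" by linarith
  then show ?thesis
  proof cases
    case 1
    then obtain d where "m = Suc (Suc (k + d))" using less_iff_Suc_add by auto
    then show ?thesis
      by (simp add: path_edge_def path_node_def sgn_refl_def lower_nbr_def)
  next
    case 2
    then have "path_edge m (Suc k) = Suc 0" "path_node m k = 1" "path_node m (Suc k) = - 1"
      by (auto simp: path_edge_def path_node_def)
    then show ?thesis by (simp add: sgn_refl_1)
  next
    case 3
    then obtain d where d: "k = m + d" using le_iff_add by blast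
    then have "path_edge m (Suc k) = d + 2" "path_node m k = 1 - int (d + 2)" "path_node m (Suc k) = - int (d + 2)"
      by (auto simp: path_edge_def path_node_def)
    then show ?thesis by (simp only: sgn_refl_ge2) simp
  qed
qed

lemma act_path_elem:
  "m \<le> n \<Longrightarrow> k < 2 * m \<Longrightarrow> act (path_elem m k) (int m) = path_node m k"
proof (induction k)
  case (Suc k)
  then have "path_edge m (Suc k) \<in> idx" using path_edge_range[of "Suc k" m] by auto
  then show ?case
    using Suc path_elem_closed[of m k] by (simp add: act_mult act_s sgn_refl_path del: atLeastAtMost_iff)
qed (auto simp: act_one path_node_def)

section \<open>Conjugation of generators by coset representatives\<close>

definition conj_by :: "'a \<Rightarrow> 'a \<Rightarrow> 'a" where
  "conj_by t g = inv t \<otimes> g \<otimes> t"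

lemma conj_by_mult:
  "\<lbrakk>r \<in> carrier W; t \<in> carrier W; g \<in> carrier W\<rbrakk> \<Longrightarrow> conj_by (r \<otimes> t) g = conj_by t (conj_by r g)"
  by (simp add: conj_by_def inv_mult_group m_assoc)

lemma conj_by_s: "i \<in> idx \<Longrightarrow> conj_by (s i) g = s i \<otimes> g \<otimes> s i"
  by (simp add: conj_by_def del: atLeastAtMost_iff)

lemma conj_by_s_commute:
  assumes "i \<in> idx" "j \<in> idx" "i + 1 < j \<or> j + 1 < i"
  shows "conj_by (s j) (s i) = s i"
  using s_commute[OF assms] assms(1,2) s_closed[of i] s_closed[of j]
  by (simp add: conj_by_s m_assoc s_sq del: atLeastAtMost_iff)

text \<open>For involutions a and b, aba = bab gives ababa = b: two conjugations turn a generator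
  into its neighbour.\<close>

lemma conj_by_s_braid3:
  assumes "i \<in> idx" "j \<in> idx" "2 \<le> i" "2 \<le> j" "i + 1 = j \<or> j + 1 = i"
  shows "conj_by (s i) (conj_by (s j) (s i)) = s j"
proof -
  have "s i \<otimes> s j \<otimes> s i = s j \<otimes> s i \<otimes> s j"
    using s_braid3[of i] s_braid3[of j] assms by (auto simp del: One_nat_def)
  then have "s j \<otimes> s i \<otimes> s j = s i \<otimes> s j \<otimes> s i" by simp
  then show ?thesis using assms(1,2) s_closed[of i] s_closed[of j]
    by (simp add: conj_by_s m_assoc s_sq del: atLeastAtMost_iff)
qed

lemma conj_by_s_braid4: "conj_by (s 2) (conj_by (s 1) (conj_by (s 2) (s 1))) = s 1"
proof -
  have i: "1 \<in> idx" "2 \<in> idx" using n_ge_2 by auto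
  note c = s_closed[OF i(1)] s_closed[OF i(2)]
  have "conj_by (s 2) (conj_by (s 1) (conj_by (s 2) (s 1)))
      = (s 2 \<otimes> s 1 \<otimes> s 2 \<otimes> s 1) \<otimes> (s 2 \<otimes> (s 1 \<otimes> s 2))"
    using c by (simp only: conj_by_s i m_assoc m_closed)
  also have "\<dots> = (s 1 \<otimes> s 2 \<otimes> s 1 \<otimes> s 2) \<otimes> (s 2 \<otimes> (s 1 \<otimes> s 2))"
    by (simp only: s_braid4)
  also have "\<dots> = s 1"
    using c by (simp only: m_assoc m_closed s_cancel i s_sq r_one)
  finally show ?thesis .
qed

text \<open>Induction backwards along the path. Either \<open>s i\<close> commutes with the last
  label and is passed on to node \<open>k - 1\<close>, or \<open>i\<close> is the label before it
  and a braid relation leads to a generator at an earlier node. At node 0 the label \<open>m\<close>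
  is excluded, so \<open>s i\<close> lies in the smaller parabolic subgroup.\<close>

lemma conj_path_elem:
  assumes "m \<le> n" "k < 2 * m" "1 \<le> i" "i \<le> m" "i \<noteq> path_edge m k" "i \<noteq> path_edge m (Suc k)"
  shows "conj_by (path_elem m k) (s i) \<in> parabolic (m - 1)"
  using assms(2-)
proof (induction k arbitrary: i rule: less_induct)
  case (less k)
  have i: "i \<in> idx" using less.prems assms(1) by auto
  show ?case
  proof (cases k)
    case 0
    then show ?thesis using less.prems i s_in_parabolic[of i "m - 1"]
      by (auto simp: conj_by_def path_edge_def)
  next
    case (Suc k1)
    define e where "e = path_edge m k"
    have e: "e \<in> idx" using path_edge_range[of k m] less.prems Suc assms(1) by (auto simp: e_def)
    have T1: "path_elem m k1 \<in> carrier W" using path_elem_closed[of m k1] Suc less.prems assms(1) by simp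
    have T: "path_elem m k = s e \<otimes> path_elem m k1" by (simp add: Suc e_def)
    have step: "conj_by (path_elem m k) (s i) = conj_by (path_elem m k1) (conj_by (s e) (s i))"
      unfolding T using e i T1 by (intro conj_by_mult) auto
    show ?thesis
    proof (cases "i = path_edge m k1")
      case False
      \<comment> \<open>Labels adjacent to \<open>e\<close> occur on the edges just before and just
        after edge \<open>k\<close>; \<open>i\<close> is on neither.\<close>
      have "i + 1 < e \<or> e + 1 < i"
        using False less.prems unfolding e_def Suc
        by (auto simp: path_edge_def split: if_splits)
      then have "conj_by (path_elem m k) (s i) = conj_by (path_elem m k1) (s i)"
        using step conj_by_s_commute[OF i e] by simp
      then show ?thesis using less.IH[of k1 i] less.prems False by (simp add: Suc)
    next
      case True
      then obtain k2 where k2: "k1 = Suc k2"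
        using less.prems by (cases k1) (auto simp: path_edge_def)
      have T2: "path_elem m k2 \<in> carrier W" using path_elem_closed[of m k2] Suc k2 less.prems assms(1) by simp
      have T1': "path_elem m k1 = s i \<otimes> path_elem m k2" by (simp add: True k2)
      have step2: "conj_by (path_elem m k) (s i) =
          conj_by (path_elem m k2) (conj_by (s i) (conj_by (s e) (s i)))"
        unfolding step unfolding T1' using i e T2
        by (intro conj_by_mult) (auto simp: conj_by_def)
      \<comment> \<open>At the turn \<open>k = m\<close> the edges on both sides of label 1 carry
        label 2, so \<open>i\<close> would also label the next edge.\<close>
      have km: "k \<noteq> m" using less.prems True Suc k2 by (auto simp: path_edge_def split: if_splits)
      show ?thesis
      \<comment> \<open>Just after the turn the last three labels are 2, 1, 2. The braid relation of
        length 4 returns \<open>s 1\<close> three nodes earlier.\<close>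
      proof (cases "k = m + 1")
        case k: True
        have e2: "e = 2" "i = 1" using k Suc True by (simp_all add: e_def path_edge_def)
        obtain k3 where k3: "k2 = Suc k3" "m = k3 + 2" using k less.prems k2 Suc
          by (cases k2) auto
        have T3: "path_elem m k3 \<in> carrier W" using path_elem_closed[of m k3] k3 assms(1) by simp
        have "path_elem m k2 = s 2 \<otimes> path_elem m k3" using k3 by (simp add: path_edge_def)
        moreover have "conj_by (s 1) (conj_by (s 2) (s 1)) \<in> carrier W"
          using i e e2 by (auto simp: conj_by_def)
        moreover have "s 2 \<in> carrier W" using e e2 by blast
        ultimately have "conj_by (path_elem m k) (s i) = conj_by (path_elem m k3) (s 1)"
          using step2 T3 conj_by_s_braid4 by (simp only: e2 conj_by_mult)
        then show ?thesis using less.IH[of k3 1] k3 k e2 Suc k2 by (simp add: path_edge_def)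
      next
        case k: False
        have k12: "k = k2 + 2" using Suc k2 by simp
        have "2 \<le> i \<and> 2 \<le> e \<and> (i + 1 = e \<or> e + 1 = i) \<and>
            e \<noteq> path_edge m k2 \<and> e \<noteq> path_edge m (Suc k2)"
        proof (cases "k < m")
          case True
          then have "e = m + 1 - k" "i = m + 2 - k" "path_edge m k2 = m + 3 - k"
            using k12 k2 \<open>i = path_edge m k1\<close> unfolding e_def by (simp_all add: path_edge_def)
          moreover obtain d where "m = Suc (k + d)" using True less_iff_Suc_add by auto
          ultimately show ?thesis using k2 \<open>i = path_edge m k1\<close> by simp
        next
          case False
          then have "e = k + 1 - m" "i = k - m" "path_edge m k2 = (if k = m + 2 then 1 else k - 1 - m)"
            using k12 k2 k km \<open>i = path_edge m k1\<close> unfolding e_def by (auto simp: path_edge_def)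
          then show ?thesis using False k km k2 \<open>i = path_edge m k1\<close> by auto
        qed
        then have bond: "2 \<le> i" "2 \<le> e" "i + 1 = e \<or> e + 1 = i"
          "e \<noteq> path_edge m k2" "e \<noteq> path_edge m (Suc k2)" by auto
        \<comment> \<open>Away from the turn the braid relation of length 3 exchanges
          \<open>s i\<close> for \<open>s e\<close> two nodes earlier.\<close>
        have "conj_by (path_elem m k) (s i) = conj_by (path_elem m k2) (s e)"
          unfolding step2 using conj_by_s_braid3[OF i e bond(1-3)] by simp
        moreover have "1 \<le> e" "e \<le> m" using path_edge_range[of k m] less.prems Suc by (auto simp: e_def)
        ultimately show ?thesis using less.IH[of k2 e] Suc k2 less.prems bond(4,5) by simp
      qed
    qed
  qed
qed

text \<open>A generator multiplied on the left moves one node back, one node forward, or, if it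
  labels neither edge, stays in the coset: its conjugate is absorbed by the right factor.\<close>

lemma parabolic_decomp:
  assumes "1 \<le> m" "m \<le> n" "w \<in> parabolic m"
  shows "\<exists>k<2 * m. \<exists>v\<in>parabolic (m - 1). w = path_elem m k \<otimes> v"
  using assms(3,2)
proof (induction rule: parabolic_induct)
  case one
  have "\<one> \<in> parabolic (m - 1)" unfolding parabolic_def by (rule generate.one)
  then show ?case using assms(1) by (intro exI[of _ 0]) force
next
  case (step i w)
  then obtain k v where k: "k < 2 * m" and v: "v \<in> parabolic (m - 1)" "w = path_elem m k \<otimes> v"
    by blast
  have c: "s i \<in> carrier W" "v \<in> carrier W" "path_elem m k \<in> carrier W"
    using step assms v k parabolic_closed[of "m - 1" v] path_elem_closed by auto
  consider "1 \<le> k" "i = path_edge m k" | "i = path_edge m (Suc k)"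
    | "i \<noteq> path_edge m k" "i \<noteq> path_edge m (Suc k)"
    using step by (cases k) (auto simp: path_edge_def)
  then show ?case
  proof cases
    case 1
    then obtain k1 where k1: "k = Suc k1" by (cases k) auto
    then have "path_elem m k1 \<in> carrier W" using path_elem_closed[of m k1] k assms by simp
    moreover have "i \<in> idx" using step assms by auto
    ultimately have "s i \<otimes> w = path_elem m k1 \<otimes> v"
      using 1 c by (simp add: v k1 m_assoc)
    then show ?thesis using v k k1 by (intro exI[of _ k1]) auto
  next
    case 2
    \<comment> \<open>At the last node the forward label is \<open>m + 1\<close>, which exceeds
      \<open>i\<close>.\<close>
    then have "Suc k < 2 * m" using step k assms by (auto simp: path_edge_def split: if_splits)
    moreover have "s i \<otimes> w = path_elem m (Suc k) \<otimes> v"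
      using 2 c by (simp add: v m_assoc)
    ultimately show ?thesis using v by blast
  next
    case 3
    have "s i \<otimes> w = path_elem m k \<otimes> (conj_by (path_elem m k) (s i) \<otimes> v)"
      using c by (simp add: conj_by_def v m_assoc)
        (simp add: m_assoc[symmetric])
    moreover have "conj_by (path_elem m k) (s i) \<otimes> v \<in> parabolic (m - 1)"
      using conj_path_elem[of m k i] 3 k step assms v parabolic_subgroup[of "m - 1"]
      by (simp add: subgroup.m_closed)
    ultimately show ?thesis using k by blast
  qed
qed

text \<open>The factor \<open>v\<close> fixes the largest point, so \<open>w\<close> sends that
  point to node \<open>k\<close>. If \<open>w\<close> acts trivially then \<open>k = 0\<close>, and
  \<open>w\<close> lies in the smaller parabolic subgroup.\<close>

lemma act_kernel_parabolic:
  "m \<le> n \<Longrightarrow> w \<in> parabolic m \<Longrightarrow> act w = id \<Longrightarrow> w = \<one>"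
proof (induction m)
  case 0
  then show ?case by (simp add: parabolic_0)
next
  case (Suc m)
  then obtain k v where k: "k < 2 * Suc m" and v: "v \<in> parabolic m" "w = path_elem (Suc m) k \<otimes> v"
    using parabolic_decomp[of "Suc m" w] by auto
  have c: "v \<in> carrier W" "path_elem (Suc m) k \<in> carrier W"
    using Suc parabolic_closed[of m v] v path_elem_closed k by auto
  have "act v (int (Suc m)) = int (Suc m)" using act_parabolic_fixes[OF v(1)] Suc by simp
  moreover have "act (path_elem (Suc m) k) (act v (int (Suc m))) = int (Suc m)"
    using Suc.prems(3) c by (metis act_mult comp_apply id_apply v(2))
  ultimately have "path_node (Suc m) k = int (Suc m)"
    using act_path_elem[of "Suc m" k] Suc.prems(1) k by simp
  then have "k = 0" by (auto simp: path_node_def split: if_splits)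
  then have "w = v" using v c by simp
  then show ?case using Suc v by simp
qed

lemma act_inj:
  assumes "u \<in> carrier W" "v \<in> carrier W" "act u = act v"
  shows "u = v"
proof -
  have "act (inv u \<otimes> v) = id"
    using assms by (simp add: act_mult fun_eq_iff) (metis act_inv_left)
  then have "inv u \<otimes> v = \<one>"
    using act_kernel_parabolic[of n] parabolic_n assms by simp
  then show ?thesis using assms by (metis inv_solve_left one_closed r_one)
qed

lemma act_transitive:
  assumes "p \<noteq> 0" "\<bar>p\<bar> \<le> int n"
  shows "\<exists>w\<in>carrier W. act w (int n) = p"
proof -
  \<comment> \<open>Solves \<open>path_node n k = p\<close>: positive values form the first half of
    the path, negative ones the second.\<close>
  define k where "k = (if p > 0 then n - nat p else n + nat (- p) - 1)"
  have "path_node n k = p" "k < 2 * n"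
    using assms n_ge_2 by (auto simp: path_node_def k_def)
  then show ?thesis using act_path_elem[of n k] path_elem_closed[of n k] by auto
qed

end

section \<open>Length and descents\<close>

context coxeter_B
begin

abbreviation len :: "'a \<Rightarrow> nat" where "len \<equiv> coxeter_length W S"

lemma len_le: "us \<in> lists S \<Longrightarrow> len (word_prod W us) \<le> length us"
  unfolding coxeter_length_def by (rule Least_le) blast

lemma reduced_word:
  assumes "w \<in> carrier W"
  shows "\<exists>us\<in>lists S. length us = len w \<and> word_prod W us = w"
proof -
  have "\<exists>k. \<exists>us\<in>lists S. length us = k \<and> word_prod W us = w" using exists_word assms by blast
  then show ?thesis unfolding coxeter_length_def by (rule LeastI_ex)
qed

lemma lower_nbr_bounds: "1 \<le> i \<Longrightarrow> lower_nbr i < int i \<and> lower_nbr i \<noteq> 0"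
  by (auto simp: lower_nbr_def)

text \<open>Conjugating a reflection by a signed permutation gives the reflection in the image pair.
  By oddness both alternatives describe the same reflection.\<close>

lemma act_sgn_refl_conj:
  assumes "w \<in> carrier W" "i \<in> idx" "r \<in> idx"
    and "act w (lower_nbr i) = lower_nbr r \<and> act w (int i) = int r \<or>
         act w (lower_nbr i) = - int r \<and> act w (int i) = - lower_nbr r"
  shows "act w (sgn_refl i x) = sgn_refl r (act w x)"
proof -
  have i: "1 \<le> i" "1 \<le> r" using assms by auto
  have at_ends: "sgn_refl j (int j) = lower_nbr j" "sgn_refl j (lower_nbr j) = int j"
    "sgn_refl j (- int j) = - lower_nbr j" "sgn_refl j (- lower_nbr j) = - int j" if "1 \<le> j" for j
    using that by (auto simp: sgn_refl_def lower_nbr_def)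
  have other: "sgn_refl j y = y"
    if "1 \<le> j" "y \<noteq> int j" "y \<noteq> lower_nbr j" "y \<noteq> - int j" "y \<noteq> - lower_nbr j" for j y
    using that by (simp add: sgn_refl_def)
  note m = act_minus[OF assms(1)]
  consider "x = int i" | "x = lower_nbr i" | "x = - int i" | "x = - lower_nbr i"
    | "x \<noteq> int i \<and> x \<noteq> lower_nbr i \<and> x \<noteq> - int i \<and> x \<noteq> - lower_nbr i" by blast
  then show ?thesis
  proof cases
    case 1
    then show ?thesis using assms(4)
      by (elim disjE conjE) (simp_all only: at_ends[OF i(1)] at_ends[OF i(2)] m minus_minus)
  next
    case 2
    then show ?thesis using assms(4)
      by (elim disjE conjE) (simp_all only: at_ends[OF i(1)] at_ends[OF i(2)] m minus_minus)
  next
    case 3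
    then show ?thesis using assms(4)
      by (elim disjE conjE) (simp_all only: at_ends[OF i(1)] at_ends[OF i(2)] m minus_minus)
  next
    case 4
    then show ?thesis using assms(4)
      by (elim disjE conjE) (simp_all only: at_ends[OF i(1)] at_ends[OF i(2)] m minus_minus)
  next
    case 5
    then have "act w x \<noteq> act w (int i)" "act w x \<noteq> act w (lower_nbr i)"
      "act w x \<noteq> act w (- int i)" "act w x \<noteq> act w (- lower_nbr i)"
      using act_eq_iff[OF assms(1)] by blast+
    then have "sgn_refl r (act w x) = act w x" using assms(4) i by (intro other) (auto simp: m)
    then show ?thesis using other[of i x] 5 i by simp
  qed
qed

text \<open>Exchange: if the image of the pair \<open>(lower_nbr i, i)\<close> under a word is in reversed order, then
  some letter reverses it, and by faithfulness of the action this letter cancels against \<open>s i\<close>.\<close>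

lemma exchange:
  assumes "us \<in> lists S" "i \<in> idx"
    and "act (word_prod W us) (int i) < act (word_prod W us) (lower_nbr i)"
  shows "\<exists>vs\<in>lists S. length vs < length us \<and> word_prod W vs = word_prod W us \<otimes> s i"
  using assms(1,3)
proof (induction us)
  case Nil
  then show ?case using lower_nbr_bounds[of i] assms(2) by (simp add: word_prod_Nil act_one)
next
  case (Cons x us)
  then obtain r where r: "r \<in> idx" "x = s r" using S_eq by auto
  let ?g = "word_prod W us"
  have g: "?g \<in> carrier W" using Cons.hyps by simp
  have c: "s r \<in> carrier W" "s i \<in> carrier W" using r assms(2) by auto
  show ?case
  proof (cases "act ?g (int i) < act ?g (lower_nbr i)")
    case True
    then obtain vs where vs: "vs \<in> lists S" "length vs < length us" "word_prod W vs = ?g \<otimes> s i"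
      using Cons.IH by blast
    then show ?thesis using r c g Cons.hyps
      by (intro bexI[of _ "x # vs"]) (simp_all add: word_prod_Cons m_assoc)
  next
    case False
    have i: "lower_nbr i < int i" "lower_nbr i \<noteq> 0" "int i \<noteq> 0"
      using lower_nbr_bounds[of i] assms(2) by auto
    then have "act ?g (lower_nbr i) < act ?g (int i)"
      using False act_eq_iff[OF g, of "lower_nbr i" "int i"] by linarith
    moreover have "sgn_refl r (act ?g (int i)) < sgn_refl r (act ?g (lower_nbr i))"
      using Cons.prems r c g by (simp add: word_prod_Cons act_mult act_s del: atLeastAtMost_iff)
    ultimately have "act ?g (lower_nbr i) = lower_nbr r \<and> act ?g (int i) = int r \<or>
         act ?g (lower_nbr i) = - int r \<and> act ?g (int i) = - lower_nbr r"
      using r i act_eq_0_iff[OF g] by (intro sgn_refl_reversal) auto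
    then have "act ?g (sgn_refl i z) = sgn_refl r (act ?g z)" for z
      using act_sgn_refl_conj[OF g assms(2) r(1)] by blast
    then have "act (?g \<otimes> s i) = act (s r \<otimes> ?g)"
      by (simp only: act_mult[OF g c(2)] act_mult[OF c(1) g] act_s[OF assms(2)] act_s[OF r(1)]
          comp_def)
    then have "?g \<otimes> s i = s r \<otimes> ?g" using c g by (intro act_inj) auto
    then have "word_prod W (x # us) \<otimes> s i = ?g"
      using c g r by (simp add: word_prod_Cons m_assoc del: atLeastAtMost_iff)
    then show ?thesis using Cons.hyps by (intro bexI[of _ us]) auto
  qed
qed

lemma len_descent:
  assumes "w \<in> carrier W" "i \<in> idx" "act w (int i) < act w (lower_nbr i)"
  shows "len (w \<otimes> s i) < len w"
proof -
  obtain us where us: "us \<in> lists S" "length us = len w" "word_prod W us = w"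
    using reduced_word assms(1) by blast
  then obtain vs where "vs \<in> lists S" "length vs < len w" "word_prod W vs = w \<otimes> s i"
    using exchange[of us i] assms by auto
  then show ?thesis using len_le[of vs] by simp
qed

text \<open>Right multiplication by \<open>s i\<close> exchanges the two values, so an ascent of
  \<open>w\<close> is a descent of the product, to which \<open>len_descent\<close> applies.\<close>

lemma len_ascent_iff:
  assumes "w \<in> carrier W" "i \<in> idx"
  shows "len w < len (w \<otimes> s i) \<longleftrightarrow> act w (lower_nbr i) < act w (int i)"
proof
  assume "len w < len (w \<otimes> s i)"
  then have "\<not> act w (int i) < act w (lower_nbr i)" using len_descent[OF assms] by (meson less_asym)
  moreover have "act w (int i) \<noteq> act w (lower_nbr i)"
    using act_eq_iff[OF assms(1)] lower_nbr_bounds[of i] assms(2) by auto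
  ultimately show "act w (lower_nbr i) < act w (int i)" by simp
next
  assume "act w (lower_nbr i) < act w (int i)"
  moreover have "sgn_refl i (int i) = lower_nbr i" "sgn_refl i (lower_nbr i) = int i"
    using assms(2) by (auto simp: sgn_refl_def)
  moreover have c: "s i \<in> carrier W" using assms by auto
  ultimately have "act (w \<otimes> s i) (int i) < act (w \<otimes> s i) (lower_nbr i)"
    using assms by (simp add: act_mult act_s del: atLeastAtMost_iff)
  then have "len (w \<otimes> s i \<otimes> s i) < len (w \<otimes> s i)"
    using assms c by (intro len_descent) auto
  then show "len w < len (w \<otimes> s i)" using assms c by (simp add: m_assoc s_sq del: atLeastAtMost_iff)
qed

section \<open>Signed permutations increasing on an initial segment\<close>

definition reps :: "nat \<Rightarrow> 'a set" where
  "reps k = coxeter_X W S (s ` {1..k})"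

text \<open>Only \<open>i = 1\<close> differs from the length criterion: by oddness the value at -1
  is below the value at 1 iff the latter is positive, that is, above the value at 0.\<close>

lemma reps_iff:
  assumes "k \<le> n"
  shows "w \<in> reps k \<longleftrightarrow> w \<in> carrier W \<and> (\<forall>i\<in>{1..k}. act w (int i - 1) < act w (int i))"
proof -
  have "act w (lower_nbr i) < act w (int i) \<longleftrightarrow> act w (int i - 1) < act w (int i)"
    if "w \<in> carrier W" "i \<in> {1..k}" for i
  proof (cases "i = 1")
    case True
    then show ?thesis using that(1) act_minus[of w 1] by (simp add: lower_nbr_def)
  qed (simp add: lower_nbr_def)
  moreover have "{1..k} \<subseteq> idx" using assms by auto
  ultimately show ?thesis
    using len_ascent_iff[of w] unfolding reps_def coxeter_X_def by blast
qed

lemma reps_closed: "reps k \<subseteq> carrier W"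
  by (auto simp: reps_def coxeter_X_def)

text \<open>Oddness mirrors the chain of inequalities from 0 to \<open>k\<close> to the negative
  side.\<close>

lemma reps_strict_mono:
  assumes "w \<in> reps k" "k \<le> n" "- int k \<le> x" "x < y" "y \<le> int k"
  shows "act w x < act w y"
proof -
  have w: "w \<in> carrier W" using assms reps_closed by blast
  have pos: "act w (z - 1) < act w z" if "1 \<le> z" "z \<le> int k" for z
  proof -
    have "nat z \<in> {1..k}" using that by auto
    then have "act w (int (nat z) - 1) < act w (int (nat z))" using assms reps_iff by blast
    then show ?thesis using that by simp
  qed
  have incr: "act w (z - 1) < act w z" if "1 - int k \<le> z" "z \<le> int k" for z
  proof (cases "1 \<le> z")
    case False
    then have "act w (- z) < act w (1 - z)" using pos[of "1 - z"] that by simp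
    then show ?thesis using act_minus[OF w, of "z"] act_minus[OF w, of "z - 1"] by simp
  qed (use pos that in simp)
  have "y \<le> int k \<longrightarrow> act w x < act w y"
    using assms(4)
  proof (induction y rule: int_gr_induct)
    case base
    then show ?case using incr[of "x + 1"] assms by simp
  next
    case (step z)
    then show ?case using incr[of "z + 1"] assms(3) by fastforce
  qed
  then show ?thesis using assms by simp
qed

lemma finite_carrier: "finite (carrier W)"
proof (rule inj_on_finite[of act])
  show "inj_on act (carrier W)" using act_inj by (blast intro: inj_onI)
  show "act ` carrier W \<subseteq> {p. p permutes {- int n..int n}}"
  proof (clarsimp simp: permutes_def)
    fix w assume w: "w \<in> carrier W"
    show "(\<forall>x. (- int n \<le> x \<longrightarrow> \<not> x \<le> int n) \<longrightarrow> act w x = x) \<and> (\<forall>y. \<exists>!x. act w x = y)"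
    proof (intro conjI allI impI)
      fix x assume "- int n \<le> x \<longrightarrow> \<not> x \<le> int n"
      then have "int n < \<bar>x\<bar>" by linarith
      then show "act w x = x" by (rule act_far[OF w])
    next
      fix y show "\<exists>!x. act w x = y" using act_inv_right[OF w] act_eq_iff[OF w] by metis
    qed
  qed
  show "finite {p. p permutes {- int n..int n}}" by (rule finite_permutations) simp
qed

text \<open>A strictly increasing integer map on 0, ..., n that fixes 0 and stays at most n is the
  identity. Oddness and faithfulness do the rest.\<close>

lemma reps_n: "reps n = {\<one>}"
proof -
  have "w = \<one>" if w: "w \<in> reps n" for w
  proof -
    have c: "w \<in> carrier W" using w reps_closed by blast
    have lower: "x \<le> act w x" if "0 \<le> x" "x \<le> int n" for x
      using that
    proof (induction x rule: int_ge_induct)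
      case (step z)
      then show ?case using reps_strict_mono[OF w, of z "z + 1"] by simp
    qed (use c in simp)
    have upper: "act w x \<le> x" if "x \<le> int n" "0 \<le> x" for x
      using that
    proof (induction x rule: int_le_induct)
      case base
      then show ?case using act_bounded[OF c, of "int n"] by simp
    next
      case (step z)
      then show ?case using reps_strict_mono[OF w, of "z - 1" z] by simp
    qed
    have "act w x = x" for x
    proof -
      consider "0 \<le> x" "x \<le> int n" | "0 \<le> - x" "- x \<le> int n" | "int n < \<bar>x\<bar>" by linarith
      then show ?thesis
      proof cases
        case 1 then show ?thesis using lower[of x] upper[of x] by simp
      next
        case 2 then show ?thesis using lower[of "- x"] upper[of "- x"] act_minus[OF c, of x] by simp
      next
        case 3 then show ?thesis using act_far[OF c] by simp
      qed
    qed
    then have "act w = act \<one>" by (simp add: act_one fun_eq_iff)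
    then show ?thesis by (rule act_inj[OF c one_closed])
  qed
  moreover have "\<one> \<in> reps n" by (simp add: reps_iff act_one)
  ultimately show ?thesis by blast
qed

end

section \<open>Quotients of coset representatives\<close>

context coxeter_B
begin

text \<open>Here \<open>z\<close> is the position of the value \<open>n\<close> in \<open>v\<close>.
  Beyond \<open>k\<close> it does not affect the first \<open>k\<close> comparisons; at
  \<open>k\<close> the maximum is harmless. At any other position up to \<open>k\<close> it breaks
  monotonicity, and at a negative one down to \<open>- k\<close> it makes a value that should be
  positive equal to \<open>- n\<close>.\<close>

lemma mem_reps_rel:
  assumes "u \<in> reps (n - 1)" "v \<in> carrier W" "act v z = int n" "k \<le> n"
  shows "v \<in> reps k \<longleftrightarrow> (int k < \<bar>z\<bar> \<and> u \<otimes> v \<in> reps k) \<or> (1 \<le> k \<and> z = int k \<and> u \<otimes> v \<in> reps (k - 1))"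
proof -
  have u: "u \<in> carrier W" using assms(1) reps_closed by blast
  have w: "u \<otimes> v \<in> carrier W" using u assms(2) by simp
  have bound: "\<bar>act v x\<bar> \<le> int n - 1" if "\<bar>x\<bar> \<le> int n" "x \<noteq> z" "x \<noteq> - z" for x
  proof -
    have "act v x \<noteq> int n" "act v x \<noteq> - int n"
      using that assms(3) act_eq_iff[OF assms(2)] act_minus[OF assms(2), of z] by metis+
    then show ?thesis using act_bounded[OF assms(2) that(1)] by linarith
  qed
  have z: "\<bar>z\<bar> \<le> int n" "z \<noteq> 0"
    using act_far[OF assms(2), of z] assms(3) act_0[OF assms(2)] n_ge_2 by force+
  \<comment> \<open>The values compared avoid \<open>n\<close> and \<open>- n\<close>, and
    \<open>u\<close> is increasing on all the others.\<close>
  have below: "v \<in> reps m \<longleftrightarrow> u \<otimes> v \<in> reps m" if "int m < \<bar>z\<bar>" for m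
  proof -
    have "act v x < act v y \<longleftrightarrow> act (u \<otimes> v) x < act (u \<otimes> v) y" if xy: "\<bar>x\<bar> \<le> int m" "\<bar>y\<bar> \<le> int m" for x y
    proof -
      have "\<bar>act v x\<bar> \<le> int n - 1" "\<bar>act v y\<bar> \<le> int n - 1"
        using xy \<open>int m < \<bar>z\<bar>\<close> z by (intro bound; linarith)+
      then have "act v x < act v y \<Longrightarrow> act u (act v x) < act u (act v y)"
        "act v y < act v x \<Longrightarrow> act u (act v y) < act u (act v x)"
        using n_ge_2 by (auto intro!: reps_strict_mono[OF assms(1)] simp: of_nat_diff)
      then show ?thesis using u assms(2)
        by (simp add: act_mult) (metis less_asym linorder_less_linear order_less_irrefl)
    qed
    moreover have "m \<le> n" using that z by linarith
    ultimately show ?thesis using assms(2) w by (auto simp: reps_iff)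
  qed
  consider "int k < \<bar>z\<bar>" | "1 \<le> k" "z = int k" | "1 \<le> z" "z < int k" | "z < 0" "- z \<le> int k"
    using z by linarith
  then show ?thesis
  proof cases
    case 1
    then show ?thesis using below[OF 1] by auto
  next
    case 2
    \<comment> \<open>The value \<open>n\<close> at position \<open>k\<close> is maximal, so the
      last comparison holds automatically.\<close>
    have "v \<in> reps k \<longleftrightarrow> v \<in> reps (k - 1)"
    proof
      assume "v \<in> reps (k - 1)"
      moreover have "act v (int k - 1) < act v (int k)"
        using bound[of "int k - 1"] 2 assms(3,4) by auto
      moreover have "{1..k} = insert k {1..k - 1}" using 2 by auto
      ultimately show "v \<in> reps k" using assms(4) by (simp add: reps_iff)
    qed (use assms(4) in \<open>auto simp: reps_iff\<close>)
    then show ?thesis using 2 below[of "k - 1"] by auto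
  next
    case 3
    have "v \<notin> reps k"
    proof
      assume "v \<in> reps k"
      then have "act v z < act v (z + 1)" using reps_strict_mono[of v k z "z + 1"] 3 assms(4) by simp
      then show False using act_bounded[OF assms(2), of "z + 1"] assms(3,4) 3 by simp
    qed
    then show ?thesis using 3 by auto
  next
    case 4
    have "v \<notin> reps k"
    proof
      assume "v \<in> reps k"
      then have "act v 0 < act v (- z)" using reps_strict_mono[of v k 0 "- z"] 4 assms(4) by simp
      then show False using act_minus[OF assms(2), of z] assms(2,3) by simp
    qed
    then show ?thesis using 4 by auto
  qed
qed

text \<open>The quotient of \<open>v\<close> by \<open>u\<close> fixes \<open>n\<close>, so
  \<open>mem_reps_rel\<close> with \<open>z = n\<close> puts it into \<open>reps n\<close>, which is
  trivial.\<close>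

lemma reps_act_n_inj: "inj_on (\<lambda>u. act u (int n)) (reps (n - 1))"
proof (rule inj_onI)
  fix u v assume uv: "u \<in> reps (n - 1)" "v \<in> reps (n - 1)" "act u (int n) = act v (int n)"
  then have c: "u \<in> carrier W" "v \<in> carrier W" using reps_closed by blast+
  have g: "inv u \<otimes> v \<in> carrier W" "u \<otimes> (inv u \<otimes> v) = v"
    using c by (simp_all add: m_assoc[symmetric])
  have "act (inv u \<otimes> v) (int n) = int n"
    using c uv(3) act_inv_left[OF c(1), of "int n"] by (simp add: act_mult)
  then have "inv u \<otimes> v \<in> reps n"
    using mem_reps_rel[OF uv(1) g(1), of "int n" n] uv(2) g(2) n_ge_2 by simp
  then show "u = v" using c g by (simp add: reps_n)
qed

text \<open>Take a shortest element sending \<open>n\<close> to \<open>p\<close>. Right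
  multiplication by \<open>s i\<close> with \<open>i < n\<close> keeps the image of
  \<open>n\<close>, so minimality excludes these descents.\<close>

lemma reps_act_n_surj:
  assumes "p \<noteq> 0" "\<bar>p\<bar> \<le> int n"
  shows "\<exists>u\<in>reps (n - 1). act u (int n) = p"
proof -
  let ?P = "\<lambda>w. w \<in> carrier W \<and> act w (int n) = p"
  obtain w where "?P w" using act_transitive assms by blast
  then obtain u where u: "?P u" and min: "\<And>v. ?P v \<Longrightarrow> len u \<le> len v"
    using ex_has_least_nat[of ?P w len] by blast
  have "act u (lower_nbr i) < act u (int i)" if i: "i \<in> {1..n - 1}" for i
  proof -
    have "i \<in> idx" using i by auto
    moreover from this have "s i \<in> carrier W" by blast
    moreover have "sgn_refl i (int n) = int n" using i by (intro sgn_refl_far) auto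
    ultimately have "?P (u \<otimes> s i)" using u by (simp add: act_mult act_s del: atLeastAtMost_iff)
    then have "\<not> act u (int i) < act u (lower_nbr i)"
      using min len_descent[of u i] u \<open>i \<in> idx\<close> by fastforce
    moreover have "act u (int i) \<noteq> act u (lower_nbr i)"
      using act_eq_iff[of u] u lower_nbr_bounds[of i] i by auto
    ultimately show ?thesis by linarith
  qed
  then have "len u < len (u \<otimes> s i)" if "i \<in> {1..n - 1}" for i
    using len_ascent_iff[of u i] u that by auto
  then show ?thesis using u by (intro bexI[of _ u]) (auto simp: reps_def coxeter_X_def)
qed

lemma card_abs_interval: "card {z. int k < \<bar>z\<bar> \<and> \<bar>z\<bar> \<le> int n} = 2 * (n - k)"
proof -
  have "{z. int k < \<bar>z\<bar> \<and> \<bar>z\<bar> \<le> int n} = {int k<..int n} \<union> {- int n..<- int k}" by auto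
  also have "card \<dots> = card {int k<..int n} + card {- int n..<- int k}"
    by (intro card_Un_disjoint) auto
  also have "\<dots> = 2 * (n - k)" by simp
  finally show ?thesis .
qed

text \<open>Sending \<open>u\<close> to the position of the value \<open>n\<close> in the quotient
  is a bijection from \<open>reps (n - 1)\<close> to the nonzero positions. By
  \<open>mem_reps_rel\<close> the \<open>2 * (n - k)\<close> positions beyond \<open>k\<close> count
  if \<open>w\<close> is in \<open>reps k\<close>, and position \<open>k\<close> counts if
  \<open>w\<close> is in \<open>reps (k - 1)\<close>.\<close>

lemma card_quotients:
  assumes w: "w \<in> carrier W" and k: "k \<le> n"
  shows "card {u \<in> reps (n - 1). inv u \<otimes> w \<in> reps k} =
     2 * (n - k) * of_bool (w \<in> reps k) + of_bool (1 \<le> k \<and> w \<in> reps (k - 1))"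
proof -
  let ?z = "\<lambda>u. act (inv w) (act u (int n))"
  let ?A = "{z. int k < \<bar>z\<bar> \<and> \<bar>z\<bar> \<le> int n \<and> w \<in> reps k}"
  let ?B = "{z. 1 \<le> k \<and> z = int k \<and> w \<in> reps (k - 1)}"
  have u: "inv u \<otimes> w \<in> reps k \<longleftrightarrow> ?z u \<in> ?A \<union> ?B" if "u \<in> reps (n - 1)" for u
  proof -
    have c: "u \<in> carrier W" using that reps_closed by blast
    have "act (inv u \<otimes> w) (?z u) = int n"
      using c w by (simp add: act_mult act_inv_right act_inv_left)
    moreover have "u \<otimes> (inv u \<otimes> w) = w" using c w by (simp add: m_assoc[symmetric])
    moreover have "\<bar>?z u\<bar> \<le> int n" using c w by (intro act_bounded) auto
    ultimately show ?thesis using mem_reps_rel[OF that, of "inv u \<otimes> w" "?z u" k] c w k by auto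
  qed
  have inj: "inj_on ?z (reps (n - 1))"
    using reps_act_n_inj w act_eq_iff[of "inv w"] by (auto simp: inj_on_def)
  have surj: "\<exists>u\<in>reps (n - 1). ?z u = z" if "z \<noteq> 0" "\<bar>z\<bar> \<le> int n" for z
  proof -
    have "act w z \<noteq> 0" "\<bar>act w z\<bar> \<le> int n"
      using that w act_eq_0_iff[of w z] act_bounded[of w z] by simp_all
    then obtain u where "u \<in> reps (n - 1)" "act u (int n) = act w z"
      using reps_act_n_surj by blast
    then show ?thesis using act_inv_left[OF w] by (intro bexI[of _ u]) auto
  qed
  have "?z ` {u \<in> reps (n - 1). inv u \<otimes> w \<in> reps k} = ?A \<union> ?B"
  proof (intro equalityI subsetI)
    fix z assume z: "z \<in> ?A \<union> ?B"
    then have "z \<noteq> 0" "\<bar>z\<bar> \<le> int n" using k by auto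
    then obtain u' where "u' \<in> reps (n - 1)" "?z u' = z" using surj by blast
    then show "z \<in> ?z ` {u \<in> reps (n - 1). inv u \<otimes> w \<in> reps k}"
      using u[of u'] z by (intro image_eqI[of _ _ u']) auto
  qed (use u in auto)
  moreover have "inj_on ?z {u \<in> reps (n - 1). inv u \<otimes> w \<in> reps k}"
    using inj by (rule inj_on_subset) auto
  ultimately have "card {u \<in> reps (n - 1). inv u \<otimes> w \<in> reps k} = card (?A \<union> ?B)"
    using card_image by fastforce
  also have "\<dots> = card ?A + card ?B"
  proof (rule card_Un_disjoint)
    show "finite ?A" by (rule finite_subset[of _ "{- int n..int n}"]) auto
    show "finite ?B" by (rule finite_subset[of _ "{int k}"]) auto
  qed auto
  also have "card ?A = 2 * (n - k) * of_bool (w \<in> reps k)"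
    using card_abs_interval[of k] by simp
  also have "card ?B = of_bool (1 \<le> k \<and> w \<in> reps (k - 1))" by simp
  finally show ?thesis .
qed

end

section \<open>The product formula\<close>

lemma finsum_group_algebra_apply:
  assumes "finite I" "\<And>i. i \<in> I \<Longrightarrow> f i \<in> carrier (group_algebra W)"
  shows "(\<Oplus>\<^bsub>group_algebra W\<^esub>i\<in>I. f i) w = (\<Sum>i\<in>I. f i w)"
  using assms
proof (induction I)
  case empty
  interpret abelian_group "group_algebra W" by (rule abelian_group_group_algebra)
  show ?case by (subst finsum_empty) (simp add: group_algebra_def)
next
  case (insert i I)
  interpret abelian_group "group_algebra W" by (rule abelian_group_group_algebra)
  have "(\<Oplus>\<^bsub>group_algebra W\<^esub>i\<in>insert i I. f i) = f i \<oplus>\<^bsub>group_algebra W\<^esub> (\<Oplus>\<^bsub>group_algebra W\<^esub>i\<in>I. f i)"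
    using insert by (intro finsum_insert) auto
  then show ?case using insert by (simp add: group_algebra_def)
qed

text \<open>With \<open>d = a - r\<close> we have \<open>b - q = Suc d\<close>, so absorption turns
  \<open>Suc q * (b choose Suc q)\<close> into \<open>Suc d * (b choose q)\<close>;
  \<open>Suc d\<close> and 2 then enter the factorial and the power.\<close>

lemma binomial_coeff_step:
  fixes a b r q :: nat
  assumes "b + r = Suc a + q"
  shows "2 * Suc q * ((a choose r) * (b choose Suc q) * fact (a - r) * 2 ^ (a - r)) =
    (a choose r) * (b choose q) * fact (Suc a - r) * 2 ^ (Suc a - r)"
proof (cases "r \<le> a")
  case True
  then obtain d where d: "a = r + d" using le_iff_add by blast
  then have b: "b = Suc d + q" using assms by simp
  have "Suc q * (b choose Suc q) = Suc d * (b choose q)"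
    using binomial_absorb_comp[of b q] binomial_absorption[of q b] by (simp add: b)
  then have "2 * (Suc q * (b choose Suc q)) * ((a choose r) * fact (a - r) * 2 ^ (a - r)) =
      2 * (Suc d * (b choose q)) * ((a choose r) * fact (a - r) * 2 ^ (a - r))"
    by simp
  also have "\<dots> = (a choose r) * (b choose q) * (Suc d * fact d) * (2 * 2 ^ d)"
    by (simp only: d diff_add_inverse mult_ac)
  also have "\<dots> = (a choose r) * (b choose q) * fact (Suc a - r) * 2 ^ (Suc a - r)"
    by (simp add: d Suc_diff_le)
  finally show ?thesis by (simp only: mult_ac)
qed (simp add: binomial_eq_0)

text \<open>The guard prevents truncated \<open>k - l\<close> and \<open>j - l\<close> from
  producing spurious terms. For \<open>j\<close> at most \<open>n\<close>, a truncated exponent is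
  harmless: \<open>n + l < j + k\<close> means \<open>n - j < k - l\<close>, so the first binomial
  vanishes.\<close>

definition coeff_B :: "nat \<Rightarrow> nat \<Rightarrow> nat \<Rightarrow> nat \<Rightarrow> nat" where
  "coeff_B n j k l = (if l \<le> j \<and> l \<le> k then ((n - j) choose (k - l)) * ((n - k) choose (j - l)) *
     fact (n + l - (j + k)) * 2 ^ (n + l - (j + k)) else 0)"

text \<open>Pascal's rule splits \<open>(n - j) choose (k - l)\<close>; one summand gives the
  coefficient at \<open>Suc l\<close>, the other is treated by
  \<open>binomial_coeff_step\<close>.\<close>

lemma coeff_B_step:
  assumes "j < n" "k \<le> n"
  shows "rat_of_nat (coeff_B n j k l) =
    2 * (rat_of_nat (Suc j) - rat_of_nat l) * rat_of_nat (coeff_B n (Suc j) k l) + rat_of_nat (coeff_B n (Suc j) k (Suc l))"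
proof (cases "l \<le> j \<and> l \<le> k")
  case False
  \<comment> \<open>At \<open>l = Suc j\<close> the first coefficient on the right may be nonzero,
    but its factor vanishes.\<close>
  then show ?thesis by (cases "l = Suc j") (auto simp: coeff_B_def)
next
  case True
  define a b r q where "a = n - Suc j" and "b = n - k" and "r = k - l" and "q = j - l"
  have eqs: "n - j = Suc a" "n - Suc j = a" "n - k = b" "k - l = r" "j - l = q" "Suc j - l = Suc q"
    "n + l - (j + k) = Suc a - r" "n + l - (Suc j + k) = a - r" "n + Suc l - (Suc j + k) = Suc a - r"
    "k - Suc l = r - 1" "Suc j - Suc l = q"
    using assms True by (auto simp: a_def b_def r_def q_def)
  have rel: "b + r = Suc a + q" using assms True by (auto simp: a_def b_def r_def q_def)
  have "coeff_B n j k l = 2 * Suc q * coeff_B n (Suc j) k l + coeff_B n (Suc j) k (Suc l)"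
  proof (cases r)
    case 0
    then have "l = k" using True by (simp add: r_def)
    then show ?thesis
      using True binomial_coeff_step[OF rel] 0 by (simp add: coeff_B_def eqs[unfolded \<open>l = k\<close>])
  next
    case (Suc r1)
    then have "Suc l \<le> k" by (simp add: r_def)
    then have "coeff_B n (Suc j) k (Suc l) = (a choose r1) * (b choose q) * fact (Suc a - r) * 2 ^ (Suc a - r)"
      using True unfolding coeff_B_def eqs by (simp add: Suc)
    moreover have "coeff_B n j k l = (Suc a choose r) * (b choose q) * fact (Suc a - r) * 2 ^ (Suc a - r)"
      "coeff_B n (Suc j) k l = (a choose r) * (b choose Suc q) * fact (a - r) * 2 ^ (a - r)"
      using True unfolding coeff_B_def eqs by simp_all
    moreover have "(Suc a choose r) = (a choose r) + (a choose r1)" by (simp add: Suc)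
    ultimately show ?thesis
      using binomial_coeff_step[OF rel] by (simp only: distrib_right)
  qed
  moreover have "rat_of_nat (Suc j) - rat_of_nat l = rat_of_nat (Suc q)"
    using True by (simp add: q_def of_nat_diff)
  ultimately show ?thesis by (simp only: of_nat_add of_nat_mult of_nat_numeral)
qed

section \<open>Convolution and the induction on the first factor\<close>

context coxeter_B
begin

text \<open>The group algebra product summed over the whole group instead of the support of
  \<open>f\<close>, so that it is linear without side conditions.\<close>

definition conv :: "('a \<Rightarrow> rat) \<Rightarrow> ('a \<Rightarrow> rat) \<Rightarrow> 'a \<Rightarrow> rat" where
  "conv f g w = (\<Sum>u\<in>carrier W. f u * g (inv u \<otimes> w))"

lemma group_algebra_mult:
  assumes "f \<in> carrier (group_algebra W)" "w \<in> carrier W"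
  shows "(f \<otimes>\<^bsub>group_algebra W\<^esub> g) w = conv f g w"
proof -
  have "(\<Sum>u\<in>{u. f u \<noteq> 0}. f u * g (inv u \<otimes> w)) = (\<Sum>u\<in>carrier W. f u * g (inv u \<otimes> w))"
    using assms finite_carrier by (intro sum.mono_neutral_left) (auto simp: group_algebra_def)
  then show ?thesis using assms by (simp add: group_algebra_def conv_def)
qed

text \<open>Interchange the two sums and translate the inner variable by \<open>v\<close>.\<close>

lemma conv_assoc:
  assumes "w \<in> carrier W"
  shows "conv (conv f g) h w = conv f (conv g h) w"
proof -
  have "(\<Sum>u\<in>carrier W. f v * g (inv v \<otimes> u) * h (inv u \<otimes> w)) =
      (\<Sum>u\<in>carrier W. f v * (g u * h (inv u \<otimes> (inv v \<otimes> w))))" if v: "v \<in> carrier W" for v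
  proof -
    have cancel: "v \<otimes> (inv v \<otimes> u) = u" "inv v \<otimes> (v \<otimes> u) = u" if "u \<in> carrier W" for u
      using v that by (simp_all add: m_assoc[symmetric])
    show ?thesis
      by (rule sum.reindex_bij_witness[of _ "\<lambda>u. v \<otimes> u" "\<lambda>u. inv v \<otimes> u"])
         (use v assms in \<open>simp_all add: cancel inv_mult_group m_assoc\<close>)
  qed
  then have "conv f (conv g h) w = (\<Sum>v\<in>carrier W. \<Sum>u\<in>carrier W. f v * g (inv v \<otimes> u) * h (inv u \<otimes> w))"
    by (simp add: conv_def sum_distrib_left)
  also have "\<dots> = conv (conv f g) h w"
    by (subst sum.swap) (simp add: conv_def sum_distrib_right)
  finally show ?thesis ..
qed

definition rep_sum :: "nat \<Rightarrow> 'a \<Rightarrow> rat" where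
  "rep_sum k w = of_bool (w \<in> reps k)"

lemma coxeter_x_eq: "coxeter_x W S (s ` {1..k}) = rep_sum k"
proof
  fix w
  have fin: "finite (reps k)" using finite_subset[OF reps_closed finite_carrier] .
  have "coxeter_x W S (s ` {1..k}) w = (\<Sum>u\<in>reps k. group_elem u w)"
    unfolding coxeter_x_def reps_def[symmetric] using fin reps_closed
    by (intro finsum_group_algebra_apply group_elem_closed) auto
  then show "coxeter_x W S (s ` {1..k}) w = rep_sum k w"
    using fin by (simp add: group_elem_def rep_sum_def)
qed

lemma rep_sum_closed: "rep_sum k \<in> carrier (group_algebra W)"
proof -
  have "{w. rep_sum k w \<noteq> 0} \<subseteq> carrier W" using reps_closed by (auto simp: rep_sum_def)
  then show ?thesis using finite_subset[OF _ finite_carrier] by (auto simp: group_algebra_def)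
qed

text \<open>The coefficient at \<open>w\<close> counts its factorizations, as in
  \<open>card_quotients\<close>. The factor \<open>of_bool (1 \<le> k)\<close> removes the last term
  at \<open>k = 0\<close>, where \<open>k - 1\<close> is truncated.\<close>

lemma conv_rep_sum:
  assumes "w \<in> carrier W" "k \<le> n"
  shows "conv (rep_sum (n - 1)) (rep_sum k) w =
    2 * (of_nat n - of_nat k) * rep_sum k w + of_bool (1 \<le> k) * rep_sum (k - 1) w"
proof -
  have "conv (rep_sum (n - 1)) (rep_sum k) w =
      (\<Sum>u\<in>carrier W. of_bool (u \<in> {u \<in> reps (n - 1). inv u \<otimes> w \<in> reps k}))"
    unfolding conv_def rep_sum_def by (intro sum.cong) auto
  also have "\<dots> = of_nat (card {u \<in> reps (n - 1). inv u \<otimes> w \<in> reps k})"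
    using finite_carrier reps_closed by (subst sum_of_bool_eq) (auto intro!: arg_cong[where f = card])
  also have "\<dots> = 2 * (of_nat n - of_nat k) * rep_sum k w + of_bool (1 \<le> k) * rep_sum (k - 1) w"
    by (simp only: card_quotients[OF assms])
       (use assms in \<open>simp add: rep_sum_def of_nat_diff of_bool_conj\<close>)
  finally show ?thesis .
qed

lemma conv_one:
  assumes "w \<in> carrier W"
  shows "conv (rep_sum n) g w = g w"
proof -
  have "conv (rep_sum n) g w = (\<Sum>u\<in>carrier W. if u = \<one> then g w else 0)"
    unfolding conv_def by (intro sum.cong) (use assms in \<open>auto simp: rep_sum_def reps_n\<close>)
  then show ?thesis using finite_carrier by simp
qed

text \<open>Summing up to \<open>n\<close> keeps the range constant in the induction;
  \<open>coeff_B\<close> vanishes beyond \<open>j\<close> and \<open>k\<close>.\<close>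

lemma conv_product:
  assumes "j \<le> n" "k \<le> n" "w \<in> carrier W"
  shows "conv (rep_sum j) (rep_sum k) w = (\<Sum>l\<le>n. of_nat (coeff_B n j k l) * rep_sum l w)"
  using assms(1,3)
proof (induction j arbitrary: w rule: inc_induct)
  case base
  \<comment> \<open>For \<open>j = n\<close> the factor \<open>0 choose (k - l)\<close> leaves only
    \<open>l = k\<close>.\<close>
  have "(\<Sum>l\<le>n. of_nat (coeff_B n n k l) * rep_sum l w) = (\<Sum>l\<le>n. if l = k then rep_sum k w else 0)"
  proof (rule sum.cong[OF HOL.refl])
    fix l
    show "of_nat (coeff_B n n k l) * rep_sum l w = (if l = k then rep_sum k w else 0)"
      using assms(2) by (auto simp: coeff_B_def binomial_eq_0)
  qed
  then show ?case using base assms(2) by (simp add: conv_one)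
next
  case (step j)
  let ?y = "rep_sum (n - 1)" and ?J = "rep_sum (Suc j)" and ?K = "rep_sum k"
  let ?c = "\<lambda>l. rat_of_nat (coeff_B n (Suc j) k l)"
  have IH: "conv ?J ?K u = (\<Sum>l\<le>n. ?c l * rep_sum l u)" if "u \<in> carrier W" for u
    using step that by blast
  \<comment> \<open>\<open>conv_rep_sum\<close> at \<open>Suc j\<close>, solved for
    \<open>rep_sum j\<close>.\<close>
  have "conv (rep_sum j) ?K w = (\<Sum>u\<in>carrier W. (conv ?y ?J u - 2 * (of_nat n - of_nat (Suc j)) * ?J u) * ?K (inv u \<otimes> w))"
    unfolding conv_def[of "rep_sum j"]
    using conv_rep_sum[of _ "Suc j"] step.hyps by (intro sum.cong) auto
  also have "\<dots> = conv (conv ?y ?J) ?K w - 2 * (of_nat n - of_nat (Suc j)) * conv ?J ?K w"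
    by (simp only: conv_def[of "conv ?y ?J"] conv_def[of ?J ?K] left_diff_distrib sum_subtractf sum_distrib_left mult.assoc)
  also have "conv (conv ?y ?J) ?K w = conv ?y (conv ?J ?K) w"
    using step.prems by (rule conv_assoc)
  also have "\<dots> = (\<Sum>u\<in>carrier W. \<Sum>l\<le>n. ?c l * (?y u * rep_sum l (inv u \<otimes> w)))"
    unfolding conv_def[of ?y] using step.prems
    by (intro sum.cong) (simp_all add: IH sum_distrib_left ac_simps)
  also have "\<dots> = (\<Sum>l\<le>n. ?c l * conv ?y (rep_sum l) w)"
    by (subst sum.swap) (simp add: conv_def sum_distrib_left)
  also have "\<dots> = (\<Sum>l\<le>n. ?c l * (2 * (of_nat n - of_nat l) * rep_sum l w + of_bool (1 \<le> l) * rep_sum (l - 1) w))"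
    using step.prems by (intro sum.cong HOL.refl arg_cong[where f = "(*) _"] conv_rep_sum) simp_all
  \<comment> \<open>The multiples 2(n - l) and 2(n - j - 1) differ by 2(j + 1 - l), the factor in
    \<open>coeff_B_step\<close>.\<close>
  also have "\<dots> - 2 * (of_nat n - of_nat (Suc j)) * conv ?J ?K w =
      (\<Sum>l\<le>n. 2 * (of_nat (Suc j) - of_nat l) * ?c l * rep_sum l w)
      + (\<Sum>l\<le>n. of_bool (1 \<le> l) * ?c l * rep_sum (l - 1) w)"
    by (simp only: IH[OF step.prems] sum_distrib_left flip: sum_subtractf sum.distrib)
       (rule sum.cong, simp_all add: algebra_simps)
  \<comment> \<open>Index shift: the term at 0 vanishes, and so does the new coefficient at
    \<open>Suc n\<close>, because it exceeds \<open>k\<close>.\<close>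
  also have "(\<Sum>l\<le>n. of_bool (1 \<le> l) * ?c l * rep_sum (l - 1) w) = (\<Sum>l\<le>n. ?c (Suc l) * rep_sum l w)"
  proof -
    have "(\<Sum>l\<le>Suc n. of_bool (1 \<le> l) * ?c l * rep_sum (l - 1) w) = (\<Sum>l\<le>n. ?c (Suc l) * rep_sum l w)"
      by (subst sum.atMost_Suc_shift) simp
    moreover have "?c (Suc n) = 0" using assms(2) by (simp add: coeff_B_def)
    ultimately show ?thesis by simp
  qed
  also have "(\<Sum>l\<le>n. 2 * (of_nat (Suc j) - of_nat l) * ?c l * rep_sum l w) + \<dots> =
      (\<Sum>l\<le>n. of_nat (coeff_B n j k l) * rep_sum l w)"
    unfolding coeff_B_step[OF step.hyps(2) assms(2)]
    by (simp add: sum.distrib distrib_right)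
  finally show ?case .
qed

end

theorem corollary3p8:
  fixes W :: "('a, 'm) monoid_scheme" and S :: "'a set" and s :: "nat \<Rightarrow> 'a" and n j k :: nat
  assumes "n \<ge> 2"
    and "coxeter_type_B W S n s"
    and "j \<le> n" and "k \<le> n"
  defines "x \<equiv> (\<lambda>i. coxeter_x W S (s ` {1..i}))"
  shows "x j \<otimes>\<^bsub>group_algebra W\<^esub> x k =
    (\<Oplus>\<^bsub>group_algebra W\<^esub>l\<in>{0..min j k}.
      of_nat (((n - j) choose (k - l)) * ((n - k) choose (j - l)) *
              fact (n + l - (j + k)) * 2 ^ (n + l - (j + k)))
        \<odot>\<^bsub>group_algebra W\<^esub> x l)"
proof
  fix w
  have "group W" using assms(2) by (simp add: coxeter_type_B_def coxeter_system_def)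
  then interpret coxeter_B W S n s using assms(1,2) by (intro coxeter_B.intro coxeter_B_axioms.intro)
  have x: "x i = rep_sum i" for i by (simp only: x_def coxeter_x_eq)
  let ?c = "\<lambda>l. of_nat (((n - j) choose (k - l)) * ((n - k) choose (j - l)) *
              fact (n + l - (j + k)) * 2 ^ (n + l - (j + k))) :: rat"
  have "?c l \<odot>\<^bsub>group_algebra W\<^esub> x l \<in> carrier (group_algebra W)" for l
  proof -
    have "{w. ?c l * rep_sum l w \<noteq> 0} \<subseteq> {w. rep_sum l w \<noteq> 0}" by auto
    then show ?thesis using rep_sum_closed[of l] finite_subset
      by (fastforce simp: group_algebra_def x)
  qed
  then have "(\<Oplus>\<^bsub>group_algebra W\<^esub>l\<in>{0..min j k}. ?c l \<odot>\<^bsub>group_algebra W\<^esub> x l) w = 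
      (\<Sum>l\<in>{0..min j k}. (?c l \<odot>\<^bsub>group_algebra W\<^esub> x l) w)"
    by (intro finsum_group_algebra_apply) auto
  also have "\<dots> = (\<Sum>l\<in>{0..min j k}. ?c l * rep_sum l w)"
    by (simp add: group_algebra_def x)
  also have "\<dots> = (x j \<otimes>\<^bsub>group_algebra W\<^esub> x k) w"
  proof (cases "w \<in> carrier W")
    case True
    have "(\<Sum>l\<in>{0..min j k}. ?c l * rep_sum l w) = (\<Sum>l\<in>{0..min j k}. of_nat (coeff_B n j k l) * rep_sum l w)"
      by (intro sum.cong) (simp_all add: coeff_B_def)
    also have "\<dots> = (\<Sum>l\<le>n. of_nat (coeff_B n j k l) * rep_sum l w)"
      using assms(3) by (intro sum.mono_neutral_left) (auto simp: coeff_B_def)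
    finally show ?thesis
      using True assms(3,4) by (simp add: x group_algebra_mult rep_sum_closed conv_product)
  next
    case False
    \<comment> \<open>Outside the carrier the product is 0 by definition, and so is each
      summand.\<close>
    then have "rep_sum l w = 0" for l using reps_closed by (auto simp: rep_sum_def)
    then show ?thesis using False by (simp add: group_algebra_def)
  qed
  finally show "(x j \<otimes>\<^bsub>group_algebra W\<^esub> x k) w =
      (\<Oplus>\<^bsub>group_algebra W\<^esub>l\<in>{0..min j k}. ?c l \<odot>\<^bsub>group_algebra W\<^esub> x l) w" ..
qed

end
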